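(* Consider the random model with $n$ men, $n$ women, independent uniformly random complete preference lists, and independent admissibility of each pair with probability $p$, where $p=p(n)=c\,\frac{\log^2 n}{n}$ with a constant $c\in(0,1)$. Let $\mathcal Q_n^{(-)}$ and $\mathcal Q_n^{(+)}$ be the smallest and the largest total rank of wives over all (possibly partial) stable matchings. Then for every constant $\varepsilon\in(0,1)$, with probability tending to $1$ as $n\to\infty$, $$\bigl\lfloor(1-\varepsilon)(pn^3)^{1/2}\bigr\rfloor\le \mathcal Q_n^{(-)}\le\mathcal Q_n^{(+)}\le\bigl\lfloor(1+\varepsilon)(pn^3)^{1/2}\bigr\rfloor .$$ The same holds for the smallest and largest total rank of husbands, $\mathcal R_n^{(-)}$ and $\mathcal R_n^{(+)}$. That is, with probability tending to $1$ the total rank of stable wives (respectively husbands) among admissible partners is asymptotically the same for every stable matching.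
   Context: Model. There are $n$ men and $n$ women. Each man has a preference list which is a permutation (strict linear order) of all $n$ women, and each woman has a preference list which is a permutation of all $n$ men; the $2n$ lists are independent and uniformly random. Independently of the lists, each of the $n^2$ pairs (man, woman) is admissible with probability $p=p(n)$, independently of all other pairs. A (possibly partial) matching $M$ is a set of pairwise disjoint admissible pairs (man, woman). It is called stable if there is no admissible pair $(m,w)\notin M$ such that both: $m$ is unmatched in $M$ or prefers $w$ to his partner in $M$; and $w$ is unmatched in $M$ or prefers $m$ to her partner in $M$. A stable matching always exists. For a stable matching $M$ and a man $m$ matched in $M$ to $w$, the rank of his wife $w$ is $1$ plus the number of women $w'$ such that $(m,w')$ is admissible and $m$ prefers $w'$ to $w$. The total rank of wives in $M$, $Q(M)$, is the sum of these ranks over all men matched in $M$; the total rank of husbands, $R(M)$, is defined symmetrically (sum over matched women of $1$ plus the number of admissible men she prefers to her partner). $\mathcal Q_n^{(-)},\mathcal Q_n^{(+)}$ are the minimum and maximum of $Q(M)$, and $\mathcal R_n^{(-)},\mathcal R_n^{(+)}$ the minimum and maximum of $R(M)$, over all stable matchings $M$ of the instance. $\log$ is the natural logarithm. *)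

theory Defs
  imports "HOL-Probability.Probability" "HOL-Combinatorics.Multiset_Permutations"
begin

text \<open>
  Men and women are both numbered \<open>0, \<dots>, n - 1\<close>; in a pair the man comes first. An instance consists
  of the men's lists \<open>U\<close>, the women's lists \<open>V\<close> (best partner first, over all \<open>n\<close> potential partners)
  and the admissibility predicate \<open>A\<close>.
\<close>

type_synonym preferences = "nat \<Rightarrow> nat list"

definition random_preferences :: "nat \<Rightarrow> preferences pmf" where
  "random_preferences n = Pi_pmf {..<n} [] (\<lambda>_. pmf_of_set (permutations_of_set {..<n}))"

definition random_admissibility :: "nat \<Rightarrow> real \<Rightarrow> (nat \<times> nat \<Rightarrow> bool) pmf" where
  "random_admissibility n p = Pi_pmf ({..<n} \<times> {..<n}) False (\<lambda>_. bernoulli_pmf p)"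

definition random_instance ::
    "nat \<Rightarrow> real \<Rightarrow> (preferences \<times> preferences \<times> (nat \<times> nat \<Rightarrow> bool)) pmf" where
  "random_instance n p =
     pair_pmf (random_preferences n) (pair_pmf (random_preferences n) (random_admissibility n p))"

definition prefers :: "'a list \<Rightarrow> 'a \<Rightarrow> 'a \<Rightarrow> bool" where
  "prefers xs x y \<longleftrightarrow> (\<exists>i j. i < j \<and> j < length xs \<and> xs ! i = x \<and> xs ! j = y)"

definition is_matching :: "nat \<Rightarrow> (nat \<times> nat \<Rightarrow> bool) \<Rightarrow> (nat \<times> nat) set \<Rightarrow> bool" where
  "is_matching n A M \<longleftrightarrow>
     (\<forall>(m, w) \<in> M. m < n \<and> w < n \<and> A (m, w)) \<and>
     (\<forall>(m, w) \<in> M. \<forall>(m', w') \<in> M. (m, w) \<noteq> (m', w') \<longrightarrow> m \<noteq> m' \<and> w \<noteq> w')"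

definition is_blocking ::
    "nat \<Rightarrow> preferences \<Rightarrow> preferences \<Rightarrow> (nat \<times> nat \<Rightarrow> bool) \<Rightarrow> (nat \<times> nat) set \<Rightarrow> nat \<times> nat \<Rightarrow> bool" where
  "is_blocking n U V A M = (\<lambda>(m, w).
     m < n \<and> w < n \<and> A (m, w) \<and> (m, w) \<notin> M \<and>
     ((\<nexists>w'. (m, w') \<in> M) \<or> (\<exists>w'. (m, w') \<in> M \<and> prefers (U m) w w')) \<and>
     ((\<nexists>m'. (m', w) \<in> M) \<or> (\<exists>m'. (m', w) \<in> M \<and> prefers (V w) m m')))"

definition stable_matchings ::
    "nat \<Rightarrow> preferences \<Rightarrow> preferences \<Rightarrow> (nat \<times> nat \<Rightarrow> bool) \<Rightarrow> (nat \<times> nat) set set" where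
  "stable_matchings n U V A = {M. is_matching n A M \<and> (\<nexists>e. is_blocking n U V A M e)}"

definition wife_rank :: "nat \<Rightarrow> preferences \<Rightarrow> (nat \<times> nat \<Rightarrow> bool) \<Rightarrow> nat \<Rightarrow> nat \<Rightarrow> nat" where
  "wife_rank n U A m w = 1 + card {w'. w' < n \<and> A (m, w') \<and> prefers (U m) w' w}"

definition husband_rank :: "nat \<Rightarrow> preferences \<Rightarrow> (nat \<times> nat \<Rightarrow> bool) \<Rightarrow> nat \<Rightarrow> nat \<Rightarrow> nat" where
  "husband_rank n V A w m = 1 + card {m'. m' < n \<and> A (m', w) \<and> prefers (V w) m' m}"

text \<open>
  Each matched man, and each matched woman, occurs in exactly one pair of a matching, so summing over
  pairs is summing over matched men (women).
\<close>

definition total_wife_rank ::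
    "nat \<Rightarrow> preferences \<Rightarrow> (nat \<times> nat \<Rightarrow> bool) \<Rightarrow> (nat \<times> nat) set \<Rightarrow> nat" where
  "total_wife_rank n U A M = (\<Sum>(m, w)\<in>M. wife_rank n U A m w)"

definition total_husband_rank ::
    "nat \<Rightarrow> preferences \<Rightarrow> (nat \<times> nat \<Rightarrow> bool) \<Rightarrow> (nat \<times> nat) set \<Rightarrow> nat" where
  "total_husband_rank n V A M = (\<Sum>(m, w)\<in>M. husband_rank n V A w m)"

text \<open>
  The set of stable matchings is finite, and nonempty by Gale and Shapley, so the following
  minima and maxima are attained.
\<close>

definition Q_min :: "nat \<Rightarrow> preferences \<Rightarrow> preferences \<Rightarrow> (nat \<times> nat \<Rightarrow> bool) \<Rightarrow> nat" where
  "Q_min n U V A = Min (total_wife_rank n U A ` stable_matchings n U V A)"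

definition Q_max :: "nat \<Rightarrow> preferences \<Rightarrow> preferences \<Rightarrow> (nat \<times> nat \<Rightarrow> bool) \<Rightarrow> nat" where
  "Q_max n U V A = Max (total_wife_rank n U A ` stable_matchings n U V A)"

definition R_min :: "nat \<Rightarrow> preferences \<Rightarrow> preferences \<Rightarrow> (nat \<times> nat \<Rightarrow> bool) \<Rightarrow> nat" where
  "R_min n U V A = Min (total_husband_rank n V A ` stable_matchings n U V A)"

definition R_max :: "nat \<Rightarrow> preferences \<Rightarrow> preferences \<Rightarrow> (nat \<times> nat \<Rightarrow> bool) \<Rightarrow> nat" where
  "R_max n U V A = Max (total_husband_rank n V A ` stable_matchings n U V A)"

end

theory Submission
  imports Defs "HOL-Real_Asymp.Real_Asymp"
begin

text \<open>
  First moment method. Write \<open>r = \<surd>(p n)\<close>, so that the claim is that every stable matching has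
  total rank of wives about \<open>n r\<close>. Fix a potential matching with \<open>n - k\<close> pairs and let \<open>x i\<close>,
  \<open>y j\<close> be the relative positions of the partners in the lists (\<open>1\<close> for the unmatched). Given
  these, all comparisons are independent, and with \<open>X = \<Sum> x i\<close>, \<open>Y = \<Sum> y j\<close> the matching is
  stable with probability at most \<open>p ^ (n - k) * exp (p n - p X Y)\<close>. Averaging over \<open>y\<close> and \<open>x\<close> and
  multiplying by the number of matchings gives, up to a factor \<open>exp (k\<^sup>2 / n)\<close> and factors
  polynomial in \<open>n\<close> or of size \<open>exp (p n)\<close>, the product of the binomial probabilities of \<open>k\<close> for
  the parameters \<open>u = exp (- p X)\<close> and \<open>v = exp (- n / X)\<close>. As \<open>u v \<le> exp (- 2 r)\<close> with equality
  only for \<open>X = n / r\<close>, this is at most \<open>exp (- n exp (- r) / 2)\<close> unless \<open>X\<close> is close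
  to \<open>n / r\<close>; since \<open>c < 1\<close>, \<open>n exp (- r)\<close> is a positive power of \<open>n\<close>. The same holds for \<open>Y\<close>,
  and for \<open>X\<close>, \<open>Y\<close> close to \<open>n / r\<close> a Chernoff bound shows that the total rank is close to
  \<open>p n X\<close>, hence to \<open>n r\<close>. The husbands follow by exchanging the roles of men and women.
\<close>

subsection \<open>Stable matchings\<close>

text \<open>Unmatched persons shape the argument. At X = n / r both parameters u and v equal exp (-
  r), so k should be about n exp (- r) = n^(1 - sqrt c). If X is off by a factor 1 + \<tau> or 1 -
  \<tau>, then u and v have a large ratio, the two binomial laws of k hardly overlap, and this
  produces the gain. The competing loss exp (p n) = exp (c ln^2 n) comes from extending the sum of x
  i * y j to the pairs of the matching and is negligible in comparison. The parameters arise as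
  follows. Averaging exp (- p X Y) over y gives exp (- p X k) ((1 - exp (- p X)) / (p X))^(n - k),
  hence u. The law of X is controlled by an exponential tilt with parameter n / X, whose Laplace
  transform yields v. The powers of X from both sources cancel. Positions lie on a grid of N points,
  so that every law has finite support. The bounds hold for each N, and uniform lists are recovered
  as N tends to infinity with n fixed.\<close>

lemma prefers_irrefl: "distinct xs \<Longrightarrow> \<not> prefers xs x x"
  by (auto simp: prefers_def nth_eq_iff_index_eq)

lemma prefers_trans: "distinct xs \<Longrightarrow> prefers xs x y \<Longrightarrow> prefers xs y z \<Longrightarrow> prefers xs x z"
  unfolding prefers_def by (metis nth_eq_iff_index_eq order_less_trans)

lemma prefers_total:
  assumes "x \<in> set xs" "y \<in> set xs" "x \<noteq> y"
  shows "prefers xs x y \<or> prefers xs y x"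
proof -
  obtain i j where "i < length xs" "xs ! i = x" "j < length xs" "xs ! j = y"
    using assms by (auto simp: in_set_conv_nth)
  with assms(3) show ?thesis
    unfolding prefers_def by (metis linorder_neqE_nat)
qed

lemma prefers_asym: "distinct xs \<Longrightarrow> prefers xs x y \<Longrightarrow> \<not> prefers xs y x"
  using prefers_irrefl[of xs x] prefers_trans[of xs x y x] by blast

lemma prefers_best_exists:
  assumes "distinct xs" "S \<subseteq> set xs" "S \<noteq> {}"
  shows "\<exists>x\<in>S. \<forall>y\<in>S. y \<noteq> x \<longrightarrow> prefers xs x y"
proof -
  let ?P = "\<lambda>i. i < length xs \<and> xs ! i \<in> S"
  have "\<exists>i. ?P i" using assms by (metis all_not_in_conv in_set_conv_nth subsetD)
  then have P: "?P (LEAST i. ?P i)" by (rule LeastI_ex)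
  moreover have "prefers xs (xs ! (LEAST i. ?P i)) y" if y: "y \<in> S" "y \<noteq> xs ! (LEAST i. ?P i)" for y
  proof -
    obtain j where j: "j < length xs" "xs ! j = y" using y assms(2) by (meson in_set_conv_nth subsetD)
    then have "(LEAST i. ?P i) \<le> j" using y by (intro Least_le) auto
    moreover have "(LEAST i. ?P i) \<noteq> j" using j y by auto
    ultimately have "(LEAST i. ?P i) < j" by simp
    then show ?thesis unfolding prefers_def using j by blast
  qed
  ultimately show ?thesis by blast
qed

text \<open>
  A set of rejections is justified if every rejected pair \<open>(m, w)\<close> is witnessed by a man preferred
  by \<open>w\<close> whose best remaining choice is \<open>w\<close>. In a maximal justified set the best remaining
  choices of the men are distinct, and they form a stable matching.
\<close>

lemma stable_matchings_nonempty:
  assumes U: "\<And>m. m < n \<Longrightarrow> U m \<in> permutations_of_set {..<n}"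
    and V: "\<And>w. w < n \<Longrightarrow> V w \<in> permutations_of_set {..<n}"
  shows "stable_matchings n U V A \<noteq> {}"
proof -
  have dU: "distinct (U m)" "set (U m) = {..<n}" if "m < n" for m
    using U[OF that] by (auto simp: permutations_of_set_def)
  have dV: "distinct (V m)" "set (V m) = {..<n}" if "m < n" for m
    using V[OF that] by (auto simp: permutations_of_set_def)
  define choice where "choice R m w \<longleftrightarrow> m < n \<and> w < n \<and> A (m, w) \<and> (m, w) \<notin> R \<and>
      (\<forall>w'<n. A (m, w') \<and> (m, w') \<notin> R \<and> w' \<noteq> w \<longrightarrow> prefers (U m) w w')" for R m w
  define justified where "justified R \<longleftrightarrow> R \<subseteq> {..<n} \<times> {..<n} \<and>
      (\<forall>(m, w)\<in>R. \<exists>m'. choice R m' w \<and> prefers (V w) m' m)" for R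
  have choice_unique: "w = w'" if "choice R m w" "choice R m w'" for R m w w'
    using that dU(1)[of m] unfolding choice_def by (metis prefers_asym)
  have "justified {}" by (auto simp: justified_def)
  moreover have "justified R \<Longrightarrow> card R \<le> n * n" for R
    unfolding justified_def using card_mono[of "{..<n} \<times> {..<n}" R] by (auto simp: card_cartesian_product)
  ultimately have "\<exists>R. justified R \<and> (\<forall>R'. justified R' \<longrightarrow> card R' \<le> card R)"
    by (intro ex_has_greatest_nat[of justified "{}" card "Suc (n * n)"]) (auto simp: less_Suc_eq_le)
  then obtain R where R: "justified R" and "\<forall>R'. justified R' \<longrightarrow> card R' \<le> card R"
    by (elim exE conjE)
  then have Rmax: "card R' \<le> card R" if "justified R'" for R'
    using that by simp
  have "R \<subseteq> {..<n} \<times> {..<n}" using R unfolding justified_def by (rule conjunct1)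
  then have finR: "finite R" by (rule finite_subset) simp
  have inj: "m1 = m2" if c1: "choice R m1 w" and c2: "choice R m2 w" for m1 m2 w
  proof -
    have False if c1: "choice R m1 w" and c2: "choice R m2 w" and pr: "prefers (V w) m1 m2" for m1 m2 w
    proof -
      have w: "w < n" "m1 < n" "m2 < n" using c1 c2 by (auto simp: choice_def)
      have ne: "m1 \<noteq> m2" using pr prefers_irrefl[of "V w" m1] dV(1)[OF w(1)] by auto
      have keep: "choice (insert (m2, w) R) m x" if "choice R m x" "m \<noteq> m2" for m x
        using that unfolding choice_def by auto
      \<comment> \<open>\<open>w\<close> now also rejects \<open>m2\<close>, who loses to
        \<open>m1\<close>. Rejections so far witnessed by \<open>m2\<close> are at \<open>w\<close>,
        and by transitivity \<open>m1\<close> witnesses them from now on.\<close>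
      have "justified (insert (m2, w) R)"
        unfolding justified_def
      proof (intro conjI ballI)
        show "insert (m2, w) R \<subseteq> {..<n} \<times> {..<n}" using R w by (auto simp: justified_def)
      next
        fix e assume e: "e \<in> insert (m2, w) R"
        obtain m x where ex: "e = (m, x)" by force
        show "case e of (m, w') \<Rightarrow> \<exists>m'. choice (insert (m2, w) R) m' w' \<and> prefers (V w') m' m"
        proof (cases "e = (m2, w)")
          case True
          then show ?thesis using keep[OF c1 ne] pr by auto
        next
          case False
          then obtain m' where m': "choice R m' x" "prefers (V x) m' m"
            using R e ex unfolding justified_def by auto
          show ?thesis
          proof (cases "m' = m2")
            case True
            then have "x = w" using m' c2 choice_unique by blast
            then have "choice (insert (m2, w) R) m1 x" using keep[OF c1 ne] by simp
            moreover have "prefers (V x) m1 m"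
              using prefers_trans[of "V w" m1 m2 m] pr m'(2) True \<open>x = w\<close> dV(1)[OF w(1)] by simp
            ultimately show ?thesis unfolding ex by auto
          next
            case False
            then show ?thesis using keep[OF m'(1) False] m'(2) unfolding ex by auto
          qed
        qed
      qed
      then have "card (insert (m2, w) R) \<le> card R" by (rule Rmax)
      moreover have "(m2, w) \<notin> R" using c2 by (simp add: choice_def)
      ultimately show False using finR by simp
    qed
    moreover have "m1 = m2 \<or> prefers (V w) m1 m2 \<or> prefers (V w) m2 m1"
      using prefers_total[of m1 "V w" m2] c1 c2 dV[of w] unfolding choice_def by auto
    ultimately show ?thesis using c1 c2 by blast
  qed
  define M where "M = {(m, w). choice R m w}"
  have mem: "(m, w) \<in> M \<longleftrightarrow> choice R m w" for m w
    by (simp add: M_def)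
  have "is_matching n A M"
    unfolding is_matching_def
  proof (intro conjI ballI, goal_cases)
    case (1 e)
    then show ?case by (cases e) (auto simp: mem choice_def)
  next
    case (2 e)
    then show ?case
      using inj choice_unique by (cases e) (simp add: mem Ball_def split_paired_all, metis)
  qed
  moreover have "\<not> is_blocking n U V A M e" for e
  proof
    assume b: "is_blocking n U V A M e"
    obtain m w where e: "e = (m, w)" by force
    have mw: "m < n" "w < n" "A (m, w)" "\<not> choice R m w"
      using b unfolding e is_blocking_def mem by auto
    \<comment> \<open>Otherwise \<open>w\<close> would still be available to \<open>m\<close>, and
      his best remaining choice would be at least as good as \<open>w\<close>, while a blocking pair
      needs \<open>w\<close> to be better.\<close>
    have "(m, w) \<in> R"
    proof (rule ccontr)
      assume nR: "(m, w) \<notin> R"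
      define S where "S = {x. x < n \<and> A (m, x) \<and> (m, x) \<notin> R}"
      have "w \<in> S" using mw nR by (simp add: S_def)
      then obtain x where x: "x \<in> S" "\<forall>y\<in>S. y \<noteq> x \<longrightarrow> prefers (U m) x y"
        using prefers_best_exists[of "U m" S] dU[OF mw(1)] by (auto simp: S_def)
      then have cx: "choice R m x" using mw(1) unfolding choice_def S_def by auto
      then have "x \<noteq> w" using mw by auto
      then have "prefers (U m) x w" using x \<open>w \<in> S\<close> by auto
      moreover have "\<exists>w'. choice R m w' \<and> prefers (U m) w w'"
        using b cx unfolding e is_blocking_def mem case_prod_conv by blast
      then have "prefers (U m) w x" using choice_unique[OF cx] by blast
      ultimately show False using prefers_asym[of "U m" x w] dU(1)[OF mw(1)] by blast
    qed
    then obtain m' where m': "choice R m' w" "prefers (V w) m' m"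
      using R unfolding justified_def by auto
    have "\<exists>m'. choice R m' w \<and> prefers (V w) m m'"
      using b m'(1) unfolding e is_blocking_def mem case_prod_conv by blast
    then have "prefers (V w) m m'" using inj[OF m'(1)] by blast
    then show False using m' prefers_asym[of "V w" m' m] dV(1)[OF mw(2)] by blast
  qed
  ultimately show ?thesis unfolding stable_matchings_def by blast
qed

lemma is_matching_unique:
  assumes M: "is_matching n A M" and xy: "x \<in> M" "y \<in> M" "fst x = fst y \<or> snd x = snd y"
  shows "x = y"
proof -
  have "case x of (m, w) \<Rightarrow> \<forall>(m', w')\<in>M. (m, w) \<noteq> (m', w') \<longrightarrow> m \<noteq> m' \<and> w \<noteq> w'"
    using M xy(1) unfolding is_matching_def by (rule conjunct2[THEN bspec])
  then show ?thesis using xy(2,3) by (cases x, cases y) auto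
qed

lemma finite_stable_matchings: "finite (stable_matchings n U V A)"
proof (rule finite_subset)
  show "stable_matchings n U V A \<subseteq> Pow ({..<n} \<times> {..<n})"
    unfolding stable_matchings_def is_matching_def by auto
qed simp

section \<open>Exchanging the roles of men and women\<close>

lemma stable_matchings_swap:
  "stable_matchings n V U (A \<circ> prod.swap) = (\<lambda>M. prod.swap ` M) ` stable_matchings n U V A"
proof -
  have *: "prod.swap ` M \<in> stable_matchings n V U (A \<circ> prod.swap)"
    if "M \<in> stable_matchings n U V A" for M U V and A :: "nat \<times> nat \<Rightarrow> bool"
  proof -
    have mem: "(a, b) \<in> prod.swap ` M \<longleftrightarrow> (b, a) \<in> M" for a b by force
    have "is_matching n (A \<circ> prod.swap) (prod.swap ` M)"
      using that unfolding stable_matchings_def is_matching_def by fastforce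
    moreover have "is_blocking n U V A M (b, a)"
      if "is_blocking n V U (A \<circ> prod.swap) (prod.swap ` M) (a, b)" for a b
      using that unfolding is_blocking_def mem by auto
    ultimately show ?thesis using that unfolding stable_matchings_def by auto
  qed
  have "M \<in> (\<lambda>M. prod.swap ` M) ` stable_matchings n U V A"
    if "M \<in> stable_matchings n V U (A \<circ> prod.swap)" for M
    using *[OF that] by (intro image_eqI[of _ _ "prod.swap ` M"]) (auto simp: image_image comp_def)
  with * show ?thesis by blast
qed

lemma total_husband_rank_swap:
  "total_wife_rank n V (A \<circ> prod.swap) (prod.swap ` M) = total_husband_rank n V A M"
proof -
  have "total_wife_rank n V (A \<circ> prod.swap) (prod.swap ` M)
      = (\<Sum>e\<in>M. wife_rank n V (A \<circ> prod.swap) (snd e) (fst e))"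
    unfolding total_wife_rank_def
    by (subst sum.reindex) (simp_all add: prod.swap_def split_beta)
  then show ?thesis
    by (simp add: total_husband_rank_def wife_rank_def husband_rank_def split_beta)
qed

lemma R_min_eq: "R_min n U V A = Q_min n V U (A \<circ> prod.swap)"
  unfolding R_min_def Q_min_def stable_matchings_swap image_image total_husband_rank_swap ..

lemma R_max_eq: "R_max n U V A = Q_max n V U (A \<circ> prod.swap)"
  unfolding R_max_def Q_max_def stable_matchings_swap image_image total_husband_rank_swap ..

text \<open>The two families of lists are independent with the same law, and swapping only permutes
  independent coins of equal bias.\<close>

lemma random_instance_swap:
  "map_pmf (\<lambda>(U, V, A). (V, U, A \<circ> prod.swap)) (random_instance n p) = random_instance n p"
proof -
  have adm: "map_pmf (\<lambda>A. A \<circ> prod.swap) (random_admissibility n p) = random_admissibility n p"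
    unfolding random_admissibility_def
    by (rule Pi_pmf_bij_betw[symmetric]) (auto intro!: bij_betwI[of _ _ _ prod.swap])
  have "map_pmf (\<lambda>(U, V, A). (V, U, A \<circ> prod.swap)) (random_instance n p)
      = bind_pmf (random_preferences n) (\<lambda>U. bind_pmf (random_preferences n) (\<lambda>V.
          bind_pmf (random_admissibility n p) (\<lambda>A. return_pmf (V, U, A \<circ> prod.swap))))"
    unfolding random_instance_def pair_pmf_def
    by (simp add: map_bind_pmf bind_assoc_pmf bind_return_pmf)
  also have "\<dots> = bind_pmf (random_preferences n) (\<lambda>V. bind_pmf (random_preferences n) (\<lambda>U.
          bind_pmf (random_admissibility n p) (\<lambda>A. return_pmf (V, U, A \<circ> prod.swap))))"
    by (rule bind_commute_pmf)
  also have "\<dots> = bind_pmf (random_preferences n) (\<lambda>V. bind_pmf (random_preferences n) (\<lambda>U.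
          bind_pmf (map_pmf (\<lambda>A. A \<circ> prod.swap) (random_admissibility n p)) (\<lambda>A. return_pmf (V, U, A))))"
    by (simp add: bind_map_pmf)
  also have "\<dots> = random_instance n p"
    unfolding adm by (simp add: random_instance_def pair_pmf_def bind_assoc_pmf bind_return_pmf)
  finally show ?thesis .
qed

subsection \<open>Positions in uniform random permutations\<close>

text \<open>Riemann sums of t^a over [0, 1]. Telescoping the differences of consecutive (a + 1)-th
  powers encloses (a + 1) times the power sum between \<open>N ^ (a + 1)\<close> and
  \<open>(N + 1) ^ (a + 1)\<close>.\<close>

lemma tendsto_average_power:
  "(\<lambda>N. (\<Sum>m=1..N. (real m / real N) ^ a) / real N) \<longlonglongrightarrow> 1 / real (a + 1)"
proof -
  have lower: "real N ^ (a + 1) \<le> real (a + 1) * (\<Sum>m=1..N. real m ^ a)" for N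
  proof (induction N)
    case (Suc N)
    have "real (Suc N) ^ (a + 1) - real N ^ (a + 1) \<le> real (a + 1) * real (Suc N) ^ a"
    proof -
      have "real (Suc N) ^ Suc a - real N ^ Suc a
          = (real (Suc N) - real N) * (\<Sum>i<Suc a. real (Suc N) ^ i * real N ^ (a - i))"
        by (subst power_diff_sumr2) (simp add: mult_ac)
      also have "\<dots> \<le> (\<Sum>i<Suc a. real (Suc N) ^ a)"
      proof -
        have "real (Suc N) ^ i * real N ^ (a - i) \<le> real (Suc N) ^ a" if "i < Suc a" for i
        proof -
          have "real (Suc N) ^ i * real N ^ (a - i) \<le> real (Suc N) ^ i * real (Suc N) ^ (a - i)"
            by (intro mult_left_mono power_mono) auto
          also have "\<dots> = real (Suc N) ^ a" using that by (simp flip: power_add)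
          finally show ?thesis .
        qed
        then have "(\<Sum>i<Suc a. real (Suc N) ^ i * real N ^ (a - i)) \<le> (\<Sum>i<Suc a. real (Suc N) ^ a)"
          by (intro sum_mono) auto
        then show ?thesis by simp
      qed
      finally show ?thesis by simp
    qed
    with Suc show ?case by (simp add: algebra_simps)
  qed simp
  have upper: "real (a + 1) * (\<Sum>m=1..N. real m ^ a) \<le> real (N + 1) ^ (a + 1)" for N
  proof (induction N)
    case (Suc N)
    have "real (a + 1) * real (Suc N) ^ a \<le> real (Suc N + 1) ^ (a + 1) - real (N + 1) ^ (a + 1)"
    proof -
      have "real (a + 1) * real (Suc N) ^ a = (\<Sum>i<Suc a. real (Suc N) ^ a)" by simp
      also have "\<dots> \<le> (\<Sum>i<Suc a. real (Suc N + 1) ^ i * real (Suc N) ^ (a - i))"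
      proof -
        have "real (Suc N) ^ a \<le> real (Suc N + 1) ^ i * real (Suc N) ^ (a - i)" if "i < Suc a" for i
        proof -
          have "real (Suc N) ^ a = real (Suc N) ^ i * real (Suc N) ^ (a - i)"
            using that by (simp flip: power_add)
          also have "\<dots> \<le> real (Suc N + 1) ^ i * real (Suc N) ^ (a - i)"
            by (intro mult_right_mono power_mono) auto
          finally show ?thesis .
        qed
        then show ?thesis by (intro sum_mono) auto
      qed
      also have "\<dots> = (real (Suc N + 1) - real (Suc N)) * \<dots>" by simp
      also have "\<dots> = real (Suc N + 1) ^ Suc a - real (Suc N) ^ Suc a"
        by (subst power_diff_sumr2) (simp add: mult_ac)
      finally show ?thesis by simp
    qed
    with Suc show ?case by (simp add: algebra_simps)
  qed simp
  have eq: "(\<Sum>m=1..N. (real m / real N) ^ a) / real N = (\<Sum>m=1..N. real m ^ a) / real N ^ (a + 1)" for N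
    by (simp add: power_divide sum_divide_distrib mult.commute)
  show ?thesis
  proof (rule real_tendsto_sandwich)
    show "\<forall>\<^sub>F N in sequentially. 1 / real (a + 1) \<le> (\<Sum>m=1..N. (real m / real N) ^ a) / real N"
      using eventually_gt_at_top[of 0]
    proof eventually_elim
      case (elim N)
      then show ?case unfolding eq using lower[of N] by (simp add: field_simps del: of_nat_Suc)
    qed
    show "\<forall>\<^sub>F N in sequentially. (\<Sum>m=1..N. (real m / real N) ^ a) / real N
        \<le> (1 + 1 / real N) ^ (a + 1) / real (a + 1)"
      using eventually_gt_at_top[of 0]
    proof eventually_elim
      case (elim N)
      have "(1 + 1 / real N) = real (N + 1) / real N" using elim by (simp add: field_simps)
      then show ?case unfolding eq using upper[of N] elim
        by (simp add: divide_simps power_divide mult_ac add_ac del: power_Suc)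
    qed
    have "(\<lambda>N. (1 + 1 / real N) ^ (a + 1) / real (a + 1)) \<longlonglongrightarrow> (1 + 0) ^ (a + 1) / real (a + 1)"
      by (intro tendsto_intros lim_1_over_n) auto
    then show "(\<lambda>N. (1 + 1 / real N) ^ (a + 1) / real (a + 1)) \<longlonglongrightarrow> 1 / real (a + 1)" by simp
  qed simp
qed

text \<open>Riemann sums of the Beta integral. The induction rests on (1 - t)^(b + 1) = (1 - t)^b -
  t (1 - t)^b, which raises \<open>a\<close> by one in the second term.\<close>

lemma tendsto_average_beta:
  "(\<lambda>N. (\<Sum>m=1..N. (real m / real N) ^ a * (1 - real m / real N) ^ b) / real N)
     \<longlonglongrightarrow> fact a * fact b / fact (a + b + 1)"
proof (induction b arbitrary: a)
  case 0
  have "fact a * fact 0 / fact (a + 0 + 1) = 1 / real (a + 1)"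
    by (simp add: divide_simps)
  then show ?case using tendsto_average_power[of a] by simp
next
  case (Suc b)
  have "(\<lambda>N. (\<Sum>m=1..N. (real m / real N) ^ a * (1 - real m / real N) ^ b) / real N
          - (\<Sum>m=1..N. (real m / real N) ^ Suc a * (1 - real m / real N) ^ b) / real N)
     \<longlonglongrightarrow> fact a * fact b / fact (a + b + 1) - fact (Suc a) * fact b / fact (Suc a + b + 1)"
    by (intro tendsto_diff Suc)
  also have "(\<lambda>N. (\<Sum>m=1..N. (real m / real N) ^ a * (1 - real m / real N) ^ b) / real N
          - (\<Sum>m=1..N. (real m / real N) ^ Suc a * (1 - real m / real N) ^ b) / real N)
      = (\<lambda>N. (\<Sum>m=1..N. (real m / real N) ^ a * (1 - real m / real N) ^ Suc b) / real N)"
    by (simp add: diff_divide_distrib [symmetric] sum_subtractf [symmetric] algebra_simps)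
  also have "fact a * fact b / fact (a + b + 1) - fact (Suc a) * fact b / fact (Suc a + b + 1)
      = (fact a * fact (Suc b) / fact (a + Suc b + 1) :: real)"
    by (simp add: divide_simps) (simp add: algebra_simps)?
  finally show ?case .
qed

text \<open>Cutting the list at \<open>w\<close> leaves an arbitrary arrangement of \<open>S\<close>
  in front and an independent arrangement of the remaining elements behind.\<close>

lemma card_permutations_before:
  assumes "finite A" "w \<in> A" "S \<subseteq> A - {w}"
  shows "card {u \<in> permutations_of_set A. {x. prefers u x w} = S}
    = fact (card S) * fact (card A - 1 - card S)"
proof -
  let ?R = "A - {w} - S"
  have fin: "finite S" "finite ?R" using assms finite_subset by auto
  have before: "{x. prefers (xs @ w # ys) x w} = set xs" if "distinct (xs @ w # ys)" for xs ys
  proof (intro equalityI subsetI)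
    fix x assume "x \<in> {x. prefers (xs @ w # ys) x w}"
    then obtain i j where ij: "i < j" "j < length (xs @ w # ys)" "(xs @ w # ys) ! i = x" "(xs @ w # ys) ! j = w"
      by (auto simp: prefers_def)
    have "j = length xs"
    proof -
      have "(xs @ w # ys) ! length xs = w" by simp
      then show ?thesis using nth_eq_iff_index_eq[OF that ij(2), of "length xs"] ij by simp
    qed
    then show "x \<in> set xs" using ij by (auto simp: nth_append)
  next
    fix x assume "x \<in> set xs"
    then obtain i where "i < length xs" "xs ! i = x" by (auto simp: in_set_conv_nth)
    then show "x \<in> {x. prefers (xs @ w # ys) x w}"
      unfolding prefers_def mem_Collect_eq by (intro exI[of _ i] exI[of _ "length xs"]) (simp add: nth_append)
  qed
  have "bij_betw (\<lambda>(xs, ys). xs @ w # ys) (permutations_of_set S \<times> permutations_of_set ?R)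
     {u \<in> permutations_of_set A. {x. prefers u x w} = S}"
  proof (rule bij_betw_imageI)
    show "inj_on (\<lambda>(xs, ys). xs @ w # ys) (permutations_of_set S \<times> permutations_of_set ?R)"
      by (auto intro!: inj_onI dest!: length_finite_permutations_of_set)
    show "(\<lambda>(xs, ys). xs @ w # ys) ` (permutations_of_set S \<times> permutations_of_set ?R)
        = {u \<in> permutations_of_set A. {x. prefers u x w} = S}"
    proof (intro equalityI subsetI)
      fix u assume "u \<in> (\<lambda>(xs, ys). xs @ w # ys) ` (permutations_of_set S \<times> permutations_of_set ?R)"
      then obtain xs ys where u: "u = xs @ w # ys" "set xs = S" "distinct xs" "set ys = ?R" "distinct ys"
        by (auto simp: permutations_of_set_def)
      then have d: "distinct (xs @ w # ys)" using assms by auto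
      then have "u \<in> permutations_of_set A" using u assms by (auto simp: permutations_of_set_def)
      then show "u \<in> {u \<in> permutations_of_set A. {x. prefers u x w} = S}"
        using before[OF d] u by simp
    next
      fix u assume u: "u \<in> {u \<in> permutations_of_set A. {x. prefers u x w} = S}"
      then have "w \<in> set u" "distinct u" "set u = A" using assms by (auto simp: permutations_of_set_def)
      then obtain xs ys where xy: "u = xs @ w # ys" by (auto simp: in_set_conv_decomp)
      then have "set xs = S" using before[of xs ys] u \<open>distinct u\<close> by simp
      moreover have "set ys = ?R" using xy \<open>distinct u\<close> \<open>set u = A\<close> \<open>set xs = S\<close> by auto
      ultimately have "(xs, ys) \<in> permutations_of_set S \<times> permutations_of_set ?R"
        using xy \<open>distinct u\<close> by (auto simp: permutations_of_set_def)
      then show "u \<in> (\<lambda>(xs, ys). xs @ w # ys) ` (permutations_of_set S \<times> permutations_of_set ?R)"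
        using xy by force
    qed
  qed
  then have "card {u \<in> permutations_of_set A. {x. prefers u x w} = S}
      = card (permutations_of_set S \<times> permutations_of_set ?R)"
    by (rule bij_betw_same_card[symmetric])
  moreover have "card ?R = card A - 1 - card S"
    using assms fin by (simp add: card_Diff_subset)
  then have "card (permutations_of_set S \<times> permutations_of_set ?R)
      = fact (card S) * fact (card A - 1 - card S)"
    using fin by (simp add: card_cartesian_product)
  ultimately show ?thesis by simp
qed

section \<open>Finite expectations and the position model\<close>

lemma expectation_bind_pmf_finite:
  fixes h :: "'b \<Rightarrow> real"
  assumes "finite (set_pmf p)" "\<And>x. x \<in> set_pmf p \<Longrightarrow> finite (set_pmf (f x))"
  shows "measure_pmf.expectation (bind_pmf p f) h
    = measure_pmf.expectation p (\<lambda>x. measure_pmf.expectation (f x) h)"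
  using assms by (subst pmf_expectation_bind[of "set_pmf p"]) (auto simp: integral_measure_pmf[of "set_pmf p"])

lemma expectation_pair_pmf_finite:
  fixes h :: "'a \<times> 'b \<Rightarrow> real"
  assumes "finite (set_pmf p)" "finite (set_pmf q)"
  shows "measure_pmf.expectation (pair_pmf p q) h
    = measure_pmf.expectation p (\<lambda>x. measure_pmf.expectation q (\<lambda>y. h (x, y)))"
  using assms by (simp add: pair_pmf_def expectation_bind_pmf_finite)

lemma prob_eq_expectation_pmf:
  "measure_pmf.prob p S = measure_pmf.expectation p (\<lambda>x. of_bool (x \<in> S))"
proof -
  have "(\<lambda>x. of_bool (x \<in> S)) = (indicator S :: 'a \<Rightarrow> real)" by (auto simp: fun_eq_iff)
  then show ?thesis by simp
qed

lemma finite_set_Pi_pmf: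
  "finite A \<Longrightarrow> (\<And>x. x \<in> A \<Longrightarrow> finite (set_pmf (p x))) \<Longrightarrow> finite (set_pmf (Pi_pmf A d p))"
  by (auto simp: set_Pi_pmf)

definition uniform_grid :: "nat \<Rightarrow> real pmf" where
  "uniform_grid N = map_pmf (\<lambda>m. real m / real N) (pmf_of_set {1..N})"

lemma expectation_uniform_grid:
  fixes f :: "real \<Rightarrow> real"
  shows "N > 0 \<Longrightarrow> measure_pmf.expectation (uniform_grid N) f = (\<Sum>m=1..N. f (real m / real N)) / real N"
  unfolding uniform_grid_def by (simp add: integral_pmf_of_set)

lemma set_uniform_grid: "N > 0 \<Longrightarrow> set_pmf (uniform_grid N) \<subseteq> {0<..1}"
  unfolding uniform_grid_def by (auto simp: divide_simps)

lemma finite_set_uniform_grid: "N > 0 \<Longrightarrow> finite (set_pmf (uniform_grid N))"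
  unfolding uniform_grid_def by simp

text \<open>
  The fraction of the preference list that a person has to go through before meeting the partner:
  spread over a grid for the matched persons in \<open>I\<close>, and \<open>1\<close> for the others.
\<close>

definition random_positions :: "nat \<Rightarrow> nat set \<Rightarrow> nat \<Rightarrow> (nat \<Rightarrow> real) pmf" where
  "random_positions n I N = Pi_pmf {..<n} 1 (\<lambda>i. if i \<in> I then uniform_grid N else return_pmf 1)"

lemma finite_set_random_positions: "N > 0 \<Longrightarrow> finite (set_pmf (random_positions n I N))"
  unfolding random_positions_def by (intro finite_set_Pi_pmf) (auto simp: finite_set_uniform_grid)

lemma random_positions_range:
  assumes "N > 0" "x \<in> set_pmf (random_positions n I N)"
  shows "0 < x i" "x i \<le> 1" "i \<notin> I \<Longrightarrow> x i = 1"
  using assms set_uniform_grid[of N] unfolding random_positions_def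
  by (cases "i < n"; cases "i \<in> I"; force simp: set_Pi_pmf PiE_dflt_def)+

text \<open>On \<open>M\<close> the coin has bias \<open>0\<close>, since nobody is strictly preferred to himself.\<close>

definition random_comparisons :: "nat \<Rightarrow> (nat \<times> nat) set \<Rightarrow> (nat \<Rightarrow> real) \<Rightarrow> (nat \<times> nat \<Rightarrow> bool) pmf" where
  "random_comparisons n M x =
     Pi_pmf ({..<n} \<times> {..<n}) False (\<lambda>(i, j). bernoulli_pmf (if (i, j) \<in> M then 0 else x i))"

lemma finite_set_pmf_bool: "finite (set_pmf (q :: bool pmf))"
  by (rule finite_subset[of _ UNIV]) auto

lemma finite_set_random_comparisons: "finite (set_pmf (random_comparisons n M x))"
  unfolding random_comparisons_def
  by (intro finite_set_Pi_pmf) (auto simp: finite_set_pmf_bool)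

text \<open>For an unmatched man the quantifier is vacuous, so every woman counts as better than
  staying single; this agrees with his position 1.\<close>

definition above_partner :: "nat \<Rightarrow> (nat \<times> nat) set \<Rightarrow> preferences \<Rightarrow> nat \<times> nat \<Rightarrow> bool" where
  "above_partner n M U = (\<lambda>(i, j). i < n \<and> j < n \<and> (\<forall>w. (i, w) \<in> M \<longrightarrow> prefers (U i) j w))"

text \<open>The women above the partner form a given set of size s with probability s! (n - 1 - s)!
  / n!. This is the integral of t^s (1 - t)^(n - 1 - s), the weight of the same outcome under
  independent coins of bias t. Rows of unmatched men are deterministic on both sides.\<close>

lemma prob_row:
  fixes n :: nat and M :: "(nat \<times> nat) set"
  assumes M: "\<And>w. (i, w) \<in> M \<Longrightarrow> w < n" "\<And>w w'. (i, w) \<in> M \<Longrightarrow> (i, w') \<in> M \<Longrightarrow> w = w'"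
  shows "(\<lambda>N. measure_pmf.expectation (if i \<in> fst ` M then uniform_grid N else return_pmf 1)
            (\<lambda>t. \<Prod>j<n. pmf (bernoulli_pmf (if (i, j) \<in> M then 0 else t)) (\<beta> (i, j))))
     \<longlonglongrightarrow> measure_pmf.prob (pmf_of_set (permutations_of_set {..<n}))
          {u. \<forall>j<n. (\<forall>w. (i, w) \<in> M \<longrightarrow> prefers u j w) = \<beta> (i, j)}"
proof (cases "i \<in> fst ` M")
  case False
  then have nM: "(i, j) \<notin> M" for j by force
  have "(\<Prod>j<n. pmf (bernoulli_pmf 1) (\<beta> (i, j))) = of_bool (\<forall>j<n. \<beta> (i, j))"
  proof -
    have "pmf (bernoulli_pmf 1) b = of_bool b" for b by (cases b) auto
    then have "(\<Prod>j<n. pmf (bernoulli_pmf 1) (\<beta> (i, j))) = (\<Prod>j<n. of_bool (\<beta> (i, j)))" by simp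
    also have "\<dots> = of_bool (\<forall>j<n. \<beta> (i, j))"
      by (cases "\<forall>j<n. \<beta> (i, j)") (auto intro!: prod_zero)
    finally show ?thesis .
  qed
  then show ?thesis using False nM by auto
next
  case True
  then obtain w where w: "(i, w) \<in> M" by force
  have wn: "w < n" using M w by blast
  have Mw: "(i, j) \<in> M \<longleftrightarrow> j = w" for j using M w by blast
  define S where "S = {j. j < n \<and> \<beta> (i, j)}"
  let ?P = "permutations_of_set {..<n}"
  show ?thesis
  proof (cases "\<beta> (i, w)")
    case True
    \<comment> \<open>Here \<open>\<beta>\<close> claims that the partner beats herself, so both
      sides vanish.\<close>
    have weight: "(\<Prod>j<n. pmf (bernoulli_pmf (if (i, j) \<in> M then 0 else t)) (\<beta> (i, j))) = 0" for t
      using True wn by (intro prod_zero) (auto simp: Mw intro!: bexI[of _ w])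
    have empty: "?P \<inter> {u. \<forall>j<n. (\<forall>w. (i, w) \<in> M \<longrightarrow> prefers u j w) = \<beta> (i, j)} = {}"
    proof -
      have "\<not> prefers u w w" if "u \<in> ?P" for u
        using that by (intro prefers_irrefl) (simp add: permutations_of_set_def)
      then show ?thesis using True wn by (auto simp: Mw)
    qed
    show ?thesis unfolding weight by (simp add: measure_pmf_of_set empty)
  next
    case False
    have S: "S \<subseteq> {..<n} - {w}" using False by (auto simp: S_def)
    then have finS: "finite S" by (rule finite_subset) simp
    have cS: "card S \<le> n - 1" using card_mono[OF _ S] wn by simp
    have eqP: "?P \<inter> {u. \<forall>j<n. (\<forall>w. (i, w) \<in> M \<longrightarrow> prefers u j w) = \<beta> (i, j)}
        = {u \<in> ?P. {x. prefers u x w} = S}"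
    proof -
      have "{x. prefers u x w} \<subseteq> {..<n}" if "u \<in> ?P" for u
      proof
        fix x assume "x \<in> {x. prefers u x w}"
        then obtain i where "i < length u" "u ! i = x"
          unfolding prefers_def using less_trans by blast
        then have "x \<in> set u" by (auto simp: in_set_conv_nth)
        then show "x \<in> {..<n}" using that by (simp add: permutations_of_set_def)
      qed
      then show ?thesis by (auto simp: S_def Mw)
    qed
    have prob: "measure_pmf.prob (pmf_of_set ?P) {u. \<forall>j<n. (\<forall>w. (i, w) \<in> M \<longrightarrow> prefers u j w) = \<beta> (i, j)}
        = fact (card S) * fact (n - 1 - card S) / fact n"
      using wn S by (simp add: measure_pmf_of_set eqP card_permutations_before)
    have weight: "(\<Prod>j<n. pmf (bernoulli_pmf (if (i, j) \<in> M then 0 else t)) (\<beta> (i, j)))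
        = t ^ card S * (1 - t) ^ (n - 1 - card S)" if "0 \<le> t" "t \<le> 1" for t
    proof -
      have "(\<Prod>j<n. pmf (bernoulli_pmf (if (i, j) \<in> M then 0 else t)) (\<beta> (i, j)))
          = (\<Prod>j\<in>{..<n} - {w}. pmf (bernoulli_pmf t) (\<beta> (i, j)))"
        using wn False by (subst prod.remove[of _ w]) (auto simp: Mw intro!: prod.cong)
      also have "\<dots> = (\<Prod>j\<in>{..<n} - {w}. if j \<in> S then t else 1 - t)"
        using that by (intro prod.cong) (auto simp: S_def)
      also have "\<dots> = t ^ card S * (1 - t) ^ card ({..<n} - {w} - S)"
      proof -
        have "({..<n} - {w}) \<inter> {j. j \<in> S} = S" "({..<n} - {w}) \<inter> - {j. j \<in> S} = {..<n} - {w} - S"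
          using S by auto
        then show ?thesis by (subst prod.If_cases) auto
      qed
      also have "card ({..<n} - {w} - S) = n - 1 - card S"
        using S finS wn by (simp add: card_Diff_subset)
      finally show ?thesis .
    qed
    have "(\<lambda>N. (\<Sum>m=1..N. (real m / real N) ^ card S * (1 - real m / real N) ^ (n - 1 - card S)) / real N)
       \<longlonglongrightarrow> fact (card S) * fact (n - 1 - card S) / fact n"
      using tendsto_average_beta[of "card S" "n - 1 - card S"] cS wn by simp
    moreover have "\<forall>\<^sub>F N in sequentially.
        (\<Sum>m=1..N. (real m / real N) ^ card S * (1 - real m / real N) ^ (n - 1 - card S)) / real N
        = measure_pmf.expectation (if i \<in> fst ` M then uniform_grid N else return_pmf 1)
            (\<lambda>t. \<Prod>j<n. pmf (bernoulli_pmf (if (i, j) \<in> M then 0 else t)) (\<beta> (i, j)))"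
      using eventually_gt_at_top[of 0]
    proof eventually_elim
      case (elim N)
      then show ?case
        using \<open>i \<in> fst ` M\<close> by (simp add: expectation_uniform_grid weight)
    qed
    ultimately show ?thesis
      unfolding prob by (rule Lim_transform_eventually)
  qed
qed

text \<open>
  Given that a man's partner sits at relative position \<open>x i\<close>, the comparisons with the partner
  are independent coin flips with success probability \<open>x i\<close>; averaging over the
  position recovers the uniform permutation, by the Beta integral.
\<close>

lemma pmf_above_partner_limit:
  assumes M: "M \<subseteq> {..<n} \<times> {..<n}" "\<And>i w w'. (i, w) \<in> M \<Longrightarrow> (i, w') \<in> M \<Longrightarrow> w = w'"
  shows "(\<lambda>N. pmf (bind_pmf (random_positions n (fst ` M) N) (random_comparisons n M)) \<beta>)
     \<longlonglongrightarrow> pmf (map_pmf (above_partner n M) (random_preferences n)) \<beta>"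
proof (cases "\<forall>e. e \<notin> {..<n} \<times> {..<n} \<longrightarrow> \<not> \<beta> e")
  case False
  have "pmf (random_comparisons n M x) \<beta> = 0" for x
    unfolding random_comparisons_def using False by (intro pmf_Pi_outside) auto
  moreover have "above_partner n M U \<noteq> \<beta>" for U
    using False unfolding above_partner_def by (auto simp: fun_eq_iff)
  then have "pmf (map_pmf (above_partner n M) (random_preferences n)) \<beta> = 0"
    by (auto simp: pmf_eq_0_set_pmf)
  ultimately show ?thesis by (simp add: pmf_bind)
next
  case True
  define h where "h i t = (\<Prod>j<n. pmf (bernoulli_pmf (if (i, j) \<in> M then 0 else t)) (\<beta> (i, j)))" for i t
  have hx: "pmf (random_comparisons n M x) \<beta> = (\<Prod>i<n. h i (x i))" for x
    unfolding random_comparisons_def h_def using True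
    by (subst pmf_Pi') (auto simp: prod.cartesian_product split_beta intro!: prod.cong)
  have h0: "h i t \<ge> 0" for i t unfolding h_def by (intro prod_nonneg) auto
  have "pmf (bind_pmf (random_positions n (fst ` M) N) (random_comparisons n M)) \<beta>
      = (\<Prod>i<n. measure_pmf.expectation (if i \<in> fst ` M then uniform_grid N else return_pmf 1) (h i))"
    if "N > 0" for N
    unfolding pmf_bind hx random_positions_def
    by (rule expectation_prod_Pi_pmf)
       (use that in \<open>auto simp: h0 finite_set_uniform_grid intro!: integrable_measure_pmf_finite\<close>)
  then have ev: "\<forall>\<^sub>F N in sequentially.
      (\<Prod>i<n. measure_pmf.expectation (if i \<in> fst ` M then uniform_grid N else return_pmf 1) (h i))
      = pmf (bind_pmf (random_positions n (fst ` M) N) (random_comparisons n M)) \<beta>"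
    by (intro eventually_mono[OF eventually_gt_at_top[of 0]]) simp
  let ?B = "\<lambda>i. {u. \<forall>j<n. (\<forall>w. (i, w) \<in> M \<longrightarrow> prefers u j w) = \<beta> (i, j)}"
  have "(\<lambda>N. (\<Prod>i<n. measure_pmf.expectation (if i \<in> fst ` M then uniform_grid N else return_pmf 1) (h i)))
     \<longlonglongrightarrow> (\<Prod>i<n. measure_pmf.prob (pmf_of_set (permutations_of_set {..<n})) (?B i))"
    unfolding h_def using M by (intro tendsto_prod prob_row) auto
  also have "(\<Prod>i<n. measure_pmf.prob (pmf_of_set (permutations_of_set {..<n})) (?B i))
      = measure_pmf.prob (random_preferences n) (Pi {..<n} ?B)"
    unfolding random_preferences_def by (rule measure_Pi_pmf_Pi[symmetric]) simp
  also have "Pi {..<n} ?B = above_partner n M -` {\<beta>}"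
  proof (intro set_eqI iffI)
    fix U assume U: "U \<in> Pi {..<n} ?B"
    have "above_partner n M U e = \<beta> e" for e
      using U True by (cases "e \<in> {..<n} \<times> {..<n}") (auto simp: above_partner_def Pi_def)
    then show "U \<in> above_partner n M -` {\<beta>}" by auto
  qed (auto simp: above_partner_def)
  also have "measure_pmf.prob (random_preferences n) \<dots> = pmf (map_pmf (above_partner n M) (random_preferences n)) \<beta>"
    by (simp add: pmf_map)
  finally show ?thesis using ev by (rule Lim_transform_eventually)
qed

text \<open>The women's comparisons are generated for the converse matching and then swapped, so
  that all three components are indexed by (man, woman).\<close>

definition instance_law ::
  "nat \<Rightarrow> real \<Rightarrow> (nat \<times> nat) set \<Rightarrow> (nat \<Rightarrow> real) \<Rightarrow> (nat \<Rightarrow> real) \<Rightarrow>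
    ((nat \<times> nat \<Rightarrow> bool) \<times> (nat \<times> nat \<Rightarrow> bool) \<times> (nat \<times> nat \<Rightarrow> bool)) pmf" where
  "instance_law n p M x y = pair_pmf (random_comparisons n M x)
     (pair_pmf (map_pmf (\<lambda>\<gamma>. \<gamma> \<circ> prod.swap) (random_comparisons n (M\<inverse>) y)) (random_admissibility n p))"

lemma finite_set_random_admissibility: "finite (set_pmf (random_admissibility n p))"
  unfolding random_admissibility_def by (intro finite_set_Pi_pmf) (auto simp: finite_set_pmf_bool)

lemma finite_set_instance_law: "finite (set_pmf (instance_law n p M x y))"
  unfolding instance_law_def by (simp add: finite_set_random_comparisons finite_set_random_admissibility)

text \<open>Convergence of point masses suffices because all laws live on fixed finite sets, where
  the probability of \<open>E\<close> is a finite sum of products of them.\<close>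

lemma prob_pair_pmf_limit:
  assumes S: "finite S" "\<And>N. N > 0 \<Longrightarrow> set_pmf (\<mu>N N) \<subseteq> S" "set_pmf \<mu> \<subseteq> S"
    and T: "finite T" "\<And>N. N > 0 \<Longrightarrow> set_pmf (\<nu>N N) \<subseteq> T" "set_pmf \<nu> \<subseteq> T"
    and lim: "\<And>\<beta>. (\<lambda>N. pmf (\<mu>N N) \<beta>) \<longlonglongrightarrow> pmf \<mu> \<beta>" "\<And>\<gamma>. (\<lambda>N. pmf (\<nu>N N) \<gamma>) \<longlonglongrightarrow> pmf \<nu> \<gamma>"
    and \<alpha>: "finite (set_pmf \<alpha>)"
  shows "(\<lambda>N. measure_pmf.prob (pair_pmf (\<mu>N N) (pair_pmf (\<nu>N N) \<alpha>)) E)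
     \<longlonglongrightarrow> measure_pmf.prob (pair_pmf \<mu> (pair_pmf \<nu> \<alpha>)) E"
proof -
  have eq: "measure_pmf.prob (pair_pmf \<mu>' (pair_pmf \<nu>' \<alpha>)) E
      = (\<Sum>\<beta>\<in>S. (\<Sum>\<gamma>\<in>T. measure_pmf.expectation \<alpha> (\<lambda>A. of_bool ((\<beta>, \<gamma>, A) \<in> E)) * pmf \<nu>' \<gamma>) * pmf \<mu>' \<beta>)"
    if "set_pmf \<mu>' \<subseteq> S" "set_pmf \<nu>' \<subseteq> T" for \<mu>' \<nu>'
  proof -
    have fin: "finite (set_pmf \<mu>')" "finite (set_pmf \<nu>')"
      using that S(1) T(1) finite_subset by blast+
    show ?thesis
      unfolding prob_eq_expectation_pmf using fin \<alpha> that
      by (simp add: expectation_pair_pmf_finite integral_measure_pmf_real[OF S(1)] integral_measure_pmf_real[OF T(1)] subset_iff)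
  qed
  have "(\<lambda>N. \<Sum>\<beta>\<in>S. (\<Sum>\<gamma>\<in>T. measure_pmf.expectation \<alpha> (\<lambda>A. of_bool ((\<beta>, \<gamma>, A) \<in> E)) * pmf (\<nu>N N) \<gamma>) * pmf (\<mu>N N) \<beta>)
     \<longlonglongrightarrow> measure_pmf.prob (pair_pmf \<mu> (pair_pmf \<nu> \<alpha>)) E"
    unfolding eq[OF S(3) T(3)] by (intro tendsto_intros lim)
  then show ?thesis
    by (rule Lim_transform_eventually)
       (intro eventually_mono[OF eventually_gt_at_top[of 0]], simp add: eq S T)
qed

text \<open>A bound that holds for every grid size survives the limit, so the discretisation leaves
  no error term. \<open>E\<close> sees the lists only through comparisons with the partners, which
  is the part that the positions model.\<close>

lemma prob_instance_le:
  assumes M: "is_matching n A0 M"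
    and bound: "\<And>N. N > 0 \<Longrightarrow>
      measure_pmf.expectation (random_positions n (fst ` M) N) (\<lambda>x.
        measure_pmf.expectation (random_positions n (snd ` M) N) (\<lambda>y.
          measure_pmf.prob (instance_law n p M x y) E)) \<le> b"
  shows "measure_pmf.prob (random_instance n p)
     {(U, V, A). (above_partner n M U, above_partner n (M\<inverse>) V \<circ> prod.swap, A) \<in> E} \<le> b"
proof -
  have Msub: "M \<subseteq> {..<n} \<times> {..<n}" using M unfolding is_matching_def by auto
  have fun1: "w = w'" if "(i, w) \<in> M" "(i, w') \<in> M" for i w w'
    using is_matching_unique[OF M that] by simp
  have fun2: "m = m'" if "(m, j) \<in> M" "(m', j) \<in> M" for j m m'
    using is_matching_unique[OF M that] by simp
  have fst_conv: "fst ` (M\<inverse>) = snd ` M" by force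
  define B where "B = PiE_dflt ({..<n} \<times> {..<n}) False (\<lambda>_. UNIV :: bool set)"
  have finB: "finite B" unfolding B_def by (intro finite_PiE_dflt) auto
  have comp_B: "set_pmf (random_comparisons n M' x) \<subseteq> B" for M' x
    unfolding B_def random_comparisons_def by (auto simp: set_Pi_pmf PiE_dflt_def)
  have above_B: "above_partner n M' U \<in> B" for M' U
    unfolding B_def above_partner_def by (auto simp: PiE_dflt_def)
  have swap_B: "\<gamma> \<circ> prod.swap \<in> B" if "\<gamma> \<in> B" for \<gamma>
    using that unfolding B_def by (auto simp: PiE_dflt_def)
  have inj: "inj (\<lambda>\<gamma> :: nat \<times> nat \<Rightarrow> bool. \<gamma> \<circ> prod.swap)"
    by (rule inj_on_inverseI[of _ "\<lambda>\<gamma>. \<gamma> \<circ> prod.swap"]) (simp add: comp_def)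
  have swap_pmf: "pmf (map_pmf (\<lambda>\<gamma>. \<gamma> \<circ> prod.swap) q) \<gamma> = pmf q (\<gamma> \<circ> prod.swap)"
    for q and \<gamma> :: "nat \<times> nat \<Rightarrow> bool"
    using pmf_map_inj'[OF inj, of q "\<gamma> \<circ> prod.swap"] by (simp add: comp_def)
  define \<mu>N where "\<mu>N N = bind_pmf (random_positions n (fst ` M) N) (random_comparisons n M)" for N
  define \<nu>N where "\<nu>N N = map_pmf (\<lambda>\<gamma>. \<gamma> \<circ> prod.swap)
    (bind_pmf (random_positions n (snd ` M) N) (random_comparisons n (M\<inverse>)))" for N
  define \<mu> where "\<mu> = map_pmf (above_partner n M) (random_preferences n)"
  define \<nu> where "\<nu> = map_pmf (\<lambda>\<gamma>. \<gamma> \<circ> prod.swap) (map_pmf (above_partner n (M\<inverse>)) (random_preferences n))"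
  let ?\<alpha> = "random_admissibility n p"
  have "(\<lambda>N. measure_pmf.prob (pair_pmf (\<mu>N N) (pair_pmf (\<nu>N N) ?\<alpha>)) E)
     \<longlonglongrightarrow> measure_pmf.prob (pair_pmf \<mu> (pair_pmf \<nu> ?\<alpha>)) E"
  proof (rule prob_pair_pmf_limit[OF finB _ _ finB])
    show "(\<lambda>N. pmf (\<mu>N N) \<beta>) \<longlonglongrightarrow> pmf \<mu> \<beta>" for \<beta>
      unfolding \<mu>N_def \<mu>_def using Msub fun1 by (rule pmf_above_partner_limit)
    show "(\<lambda>N. pmf (\<nu>N N) \<gamma>) \<longlonglongrightarrow> pmf \<nu> \<gamma>" for \<gamma>
      unfolding \<nu>N_def \<nu>_def swap_pmf fst_conv[symmetric]
      using Msub fun2 by (intro pmf_above_partner_limit) auto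
  qed (use comp_B above_B swap_B in \<open>auto simp: \<mu>N_def \<nu>N_def \<mu>_def \<nu>_def finite_set_random_admissibility subset_iff\<close>)
  moreover have "measure_pmf.prob (pair_pmf (\<mu>N N) (pair_pmf (\<nu>N N) ?\<alpha>)) E \<le> b" if N: "N > 0" for N
  proof -
    let ?X = "random_positions n (fst ` M) N" and ?Y = "random_positions n (snd ` M) N"
    have fX: "finite (set_pmf ?X)" "finite (set_pmf ?Y)" using N by (auto intro: finite_set_random_positions)
    have "pair_pmf (\<mu>N N) (pair_pmf (\<nu>N N) ?\<alpha>)
        = bind_pmf ?X (\<lambda>x. bind_pmf (random_comparisons n M x) (\<lambda>\<beta>. bind_pmf ?Y (\<lambda>y.
            bind_pmf (random_comparisons n (M\<inverse>) y) (\<lambda>\<gamma>. bind_pmf ?\<alpha> (\<lambda>A.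
              return_pmf (\<beta>, \<gamma> \<circ> prod.swap, A))))))"
      unfolding \<mu>N_def \<nu>N_def pair_pmf_def
      by (simp add: map_bind_pmf bind_assoc_pmf bind_return_pmf map_pmf_def)
    \<comment> \<open>Both position vectors are drawn first, so that the comparisons can be treated
      conditionally on them.\<close>
    also have "\<dots> = bind_pmf ?X (\<lambda>x. bind_pmf ?Y (\<lambda>y. bind_pmf (random_comparisons n M x) (\<lambda>\<beta>.
            bind_pmf (random_comparisons n (M\<inverse>) y) (\<lambda>\<gamma>. bind_pmf ?\<alpha> (\<lambda>A.
              return_pmf (\<beta>, \<gamma> \<circ> prod.swap, A))))))"
      by (subst bind_commute_pmf) (rule refl)
    also have "\<dots> = bind_pmf ?X (\<lambda>x. bind_pmf ?Y (\<lambda>y. instance_law n p M x y))"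
      unfolding instance_law_def pair_pmf_def
      by (simp add: map_bind_pmf bind_assoc_pmf bind_return_pmf map_pmf_def)
    finally have "measure_pmf.prob (pair_pmf (\<mu>N N) (pair_pmf (\<nu>N N) ?\<alpha>)) E
        = measure_pmf.expectation ?X (\<lambda>x. measure_pmf.expectation ?Y (\<lambda>y.
            measure_pmf.prob (instance_law n p M x y) E))"
      unfolding prob_eq_expectation_pmf using fX
      by (simp add: expectation_bind_pmf_finite finite_set_instance_law)
    then show ?thesis using bound[OF N] by simp
  qed
  ultimately have "measure_pmf.prob (pair_pmf \<mu> (pair_pmf \<nu> ?\<alpha>)) E \<le> b"
    by (intro LIMSEQ_le_const2[of _ _ b]) (auto intro!: exI[of _ 1])
  also have "pair_pmf \<mu> (pair_pmf \<nu> ?\<alpha>)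
      = map_pmf (\<lambda>(U, V, A). (above_partner n M U, above_partner n (M\<inverse>) V \<circ> prod.swap, A)) (random_instance n p)"
    unfolding \<mu>_def \<nu>_def random_instance_def pair_pmf_def
    by (simp add: map_bind_pmf bind_assoc_pmf bind_return_pmf map_pmf_def)
  finally show ?thesis by (simp add: vimage_def case_prod_unfold)
qed

subsection \<open>The probability that a matching is stable\<close>

text \<open>Since all comparisons of unmatched persons are true, one condition covers blocking by
  matched and by unmatched persons.\<close>

definition pattern_stable ::
  "nat \<Rightarrow> (nat \<times> nat) set \<Rightarrow> (nat \<times> nat \<Rightarrow> bool) \<Rightarrow> (nat \<times> nat \<Rightarrow> bool) \<Rightarrow> (nat \<times> nat \<Rightarrow> bool) \<Rightarrow> bool" where
  "pattern_stable n M \<beta> \<gamma> A \<longleftrightarrow>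
     (\<forall>e\<in>M. A e) \<and> (\<forall>e\<in>{..<n} \<times> {..<n} - M. \<not> (A e \<and> \<beta> e \<and> \<gamma> e))"

definition matched_rows :: "nat \<Rightarrow> (nat \<times> nat) set \<Rightarrow> (nat \<times> nat) set" where
  "matched_rows n M = {e \<in> {..<n} \<times> {..<n} - M. fst e \<in> fst ` M}"

text \<open>The total rank of wives without the summand 1 of each matched man; those summands add up
  to \<open>card M\<close>.\<close>

definition pattern_rank :: "nat \<Rightarrow> (nat \<times> nat) set \<Rightarrow> (nat \<times> nat \<Rightarrow> bool) \<Rightarrow> (nat \<times> nat \<Rightarrow> bool) \<Rightarrow> nat" where
  "pattern_rank n M \<beta> A = card {e \<in> matched_rows n M. A e \<and> \<beta> e}"

lemma map_swap_random_comparisons: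
  "map_pmf (\<lambda>\<gamma>. \<gamma> \<circ> prod.swap) (random_comparisons n (M\<inverse>) y)
   = Pi_pmf ({..<n} \<times> {..<n}) False (\<lambda>(i, j). bernoulli_pmf (if (i, j) \<in> M then 0 else y j))"
proof (rule pmf_eqI)
  fix \<gamma> :: "nat \<times> nat \<Rightarrow> bool"
  have inj: "inj (\<lambda>\<gamma> :: nat \<times> nat \<Rightarrow> bool. \<gamma> \<circ> prod.swap)"
    by (rule inj_on_inverseI[of _ "\<lambda>\<gamma>. \<gamma> \<circ> prod.swap"]) (simp add: comp_def)
  have "pmf (map_pmf (\<lambda>\<gamma>. \<gamma> \<circ> prod.swap) (random_comparisons n (M\<inverse>) y)) \<gamma>
      = pmf (random_comparisons n (M\<inverse>) y) (\<gamma> \<circ> prod.swap)"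
    using pmf_map_inj'[OF inj, of _ "\<gamma> \<circ> prod.swap"] by (simp add: comp_def)
  also have "\<dots> = pmf (Pi_pmf ({..<n} \<times> {..<n}) False (\<lambda>(i, j). bernoulli_pmf (if (i, j) \<in> M then 0 else y j))) \<gamma>"
    unfolding random_comparisons_def
    by (subst (1 2) pmf_Pi)
       (auto intro!: prod.reindex_bij_witness[of _ prod.swap prod.swap])
  finally show "pmf (map_pmf (\<lambda>\<gamma>. \<gamma> \<circ> prod.swap) (random_comparisons n (M\<inverse>) y)) \<gamma>
      = pmf (Pi_pmf ({..<n} \<times> {..<n}) False (\<lambda>(i, j). bernoulli_pmf (if (i, j) \<in> M then 0 else y j))) \<gamma>" .
qed

locale position_pattern =
  fixes n :: nat and p :: real and M :: "(nat \<times> nat) set" and A0 :: "nat \<times> nat \<Rightarrow> bool"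
    and x y :: "nat \<Rightarrow> real"
  assumes matching: "is_matching n A0 M"
    and p: "0 \<le> p" "p \<le> 1"
    and x: "\<And>i. 0 < x i" "\<And>i. x i \<le> 1" "\<And>i. i \<notin> fst ` M \<Longrightarrow> x i = 1"
    and y: "\<And>i. 0 < y i" "\<And>i. y i \<le> 1" "\<And>i. i \<notin> snd ` M \<Longrightarrow> y i = 1"
begin

abbreviation \<Omega> :: "(nat \<times> nat) set" where "\<Omega> \<equiv> {..<n} \<times> {..<n}"

definition X :: real where "X = (\<Sum>i<n. x i)"
definition Y :: real where "Y = (\<Sum>j<n. y j)"

lemma M_subset: "M \<subseteq> \<Omega>"
  using matching unfolding is_matching_def by auto

lemma finite_M: "finite M"
  using M_subset by (rule finite_subset) simp

lemma inj_fst: "inj_on fst M"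
  using is_matching_unique[OF matching] by (intro inj_onI) blast

lemma fst_M: "fst ` M \<subseteq> {..<n}"
  using M_subset by auto

lemma fst_memI: "(i, j) \<in> M \<Longrightarrow> i \<in> fst ` M"
  by force

lemma card_M_le: "card M \<le> n"
  using card_mono[OF _ fst_M] card_image[OF inj_fst] by simp

text \<open>Stability and the rank weight both factor over the pairs, so independence will turn the
  expectation into a product.\<close>

lemma pattern_product:
  assumes z: "z > 0"
  shows "of_bool (pattern_stable n M \<beta> \<gamma> A) * z ^ pattern_rank n M \<beta> A
    = (\<Prod>e\<in>\<Omega>. if e \<in> M then of_bool (A e)
         else if A e \<and> \<beta> e \<and> \<gamma> e then 0 else if A e \<and> \<beta> e \<and> fst e \<in> fst ` M then z else (1::real))"
    (is "_ = prod ?g \<Omega>")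
proof -
  have split: "prod ?g \<Omega> = prod ?g M * prod ?g (\<Omega> - M)"
    using prod.subset_diff[OF M_subset, of ?g] by (simp add: mult.commute)
  have "prod ?g M = (\<Prod>e\<in>M. of_bool (A e))" by (intro prod.cong) auto
  then have M: "prod ?g M = of_bool (\<forall>e\<in>M. A e)"
    using finite_M by (cases "\<forall>e\<in>M. A e") (auto intro!: prod_zero)
  show ?thesis
  proof (cases "\<forall>e\<in>\<Omega> - M. \<not> (A e \<and> \<beta> e \<and> \<gamma> e)")
    case True
    then have "prod ?g (\<Omega> - M) = (\<Prod>e\<in>\<Omega> - M. if e \<in> {e \<in> matched_rows n M. A e \<and> \<beta> e} then z else 1)"
      by (intro prod.cong) (auto simp: matched_rows_def)
    also have "\<dots> = z ^ card {e \<in> matched_rows n M. A e \<and> \<beta> e}"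
    proof -
      have "(\<Omega> - M) \<inter> {e \<in> matched_rows n M. A e \<and> \<beta> e} = {e \<in> matched_rows n M. A e \<and> \<beta> e}"
        by (auto simp: matched_rows_def)
      then show ?thesis by (subst prod.inter_restrict[symmetric]) simp_all
    qed
    finally have rest: "prod ?g (\<Omega> - M) = z ^ card {e \<in> matched_rows n M. A e \<and> \<beta> e}" .
    show ?thesis
      unfolding split M rest using True by (simp add: pattern_stable_def pattern_rank_def of_bool_conj)
  next
    case False
    then have rest: "prod ?g (\<Omega> - M) = 0" by (intro prod_zero) auto
    show ?thesis unfolding split rest using False by (simp add: pattern_stable_def)
  qed
qed

text \<open>Outside \<open>M\<close>, a pair is admissible and blocking with probability
  \<open>p * x i * y j\<close> and then contributes 0. If the man is matched, it raises the rank
  without blocking with probability \<open>p * x i * (1 - y j)\<close> and then contributes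
  \<open>z\<close> in place of 1.\<close>

lemma expectation_pattern:
  assumes z: "z > 0"
  shows "measure_pmf.expectation (instance_law n p M x y)
      (\<lambda>(\<beta>, \<gamma>, A). of_bool (pattern_stable n M \<beta> \<gamma> A) * z ^ pattern_rank n M \<beta> A)
    = p ^ card M * (\<Prod>(i, j)\<in>\<Omega> - M. 1 - p * x i * y j + (if i \<in> fst ` M then (z - 1) * p * x i * (1 - y j) else 0))"
proof -
  define g where "g e b c a = (if e \<in> M then of_bool a
         else if a \<and> b \<and> c then 0 else if a \<and> b \<and> fst e \<in> fst ` M then z else (1::real))" for e b c a
  have g0: "g e b c a \<ge> 0" for e b c a using z by (auto simp: g_def)
  define g1 where "g1 e b c = g e b c True * p + g e b c False * (1 - p)" for e b c
  define y' where "y' e = (if e \<in> M then 0 else y (snd e))" for e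
  define x' where "x' e = (if e \<in> M then 0 else x (fst e))" for e
  have xy': "0 \<le> x' e" "x' e \<le> 1" "0 \<le> y' e" "y' e \<le> 1" for e
    using x y by (auto simp: x'_def y'_def less_imp_le)
  have g10: "g1 e b c \<ge> 0" for e b c using g0 p by (auto simp: g1_def)
  define g2 where "g2 e b = g1 e b True * y' e + g1 e b False * (1 - y' e)" for e b
  have g20: "g2 e b \<ge> 0" for e b using g10 xy' by (auto simp: g2_def)
  have intg: "integrable (measure_pmf q) f" for q :: "bool pmf" and f :: "bool \<Rightarrow> real"
    by (intro integrable_measure_pmf_finite finite_set_pmf_bool)
  have EA: "measure_pmf.expectation (random_admissibility n p) (\<lambda>A. \<Prod>e\<in>\<Omega>. g e (\<beta> e) (\<gamma> e) (A e))
      = (\<Prod>e\<in>\<Omega>. g1 e (\<beta> e) (\<gamma> e))" for \<beta> \<gamma>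
    unfolding random_admissibility_def
    by (subst expectation_prod_Pi_pmf) (use p in \<open>auto simp: g0 intg g1_def\<close>)
  have E\<gamma>: "measure_pmf.expectation (map_pmf (\<lambda>\<gamma>. \<gamma> \<circ> prod.swap) (random_comparisons n (M\<inverse>) y))
      (\<lambda>\<gamma>. \<Prod>e\<in>\<Omega>. g1 e (\<beta> e) (\<gamma> e)) = (\<Prod>e\<in>\<Omega>. g2 e (\<beta> e))" for \<beta>
  proof -
    have "measure_pmf.expectation (map_pmf (\<lambda>\<gamma>. \<gamma> \<circ> prod.swap) (random_comparisons n (M\<inverse>) y))
      (\<lambda>\<gamma>. \<Prod>e\<in>\<Omega>. g1 e (\<beta> e) (\<gamma> e))
      = measure_pmf.expectation (Pi_pmf \<Omega> False (\<lambda>e. bernoulli_pmf (y' e))) (\<lambda>\<gamma>. \<Prod>e\<in>\<Omega>. g1 e (\<beta> e) (\<gamma> e))"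
      unfolding map_swap_random_comparisons by (simp add: y'_def case_prod_unfold)
    also have "\<dots> = (\<Prod>e\<in>\<Omega>. g2 e (\<beta> e))"
      by (subst expectation_prod_Pi_pmf) (use xy' in \<open>auto simp: g10 intg g2_def\<close>)
    finally show ?thesis .
  qed
  have E\<beta>: "measure_pmf.expectation (random_comparisons n M x) (\<lambda>\<beta>. \<Prod>e\<in>\<Omega>. g2 e (\<beta> e))
     = (\<Prod>e\<in>\<Omega>. g2 e True * x' e + g2 e False * (1 - x' e))"
  proof -
    have "random_comparisons n M x = Pi_pmf \<Omega> False (\<lambda>e. bernoulli_pmf (x' e))"
      unfolding random_comparisons_def by (simp add: x'_def case_prod_unfold)
    then show ?thesis
      by (simp only:) (subst expectation_prod_Pi_pmf, use xy' in \<open>auto simp: g20 intg\<close>)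
  qed
  have "measure_pmf.expectation (instance_law n p M x y)
      (\<lambda>(\<beta>, \<gamma>, A). of_bool (pattern_stable n M \<beta> \<gamma> A) * z ^ pattern_rank n M \<beta> A)
    = measure_pmf.expectation (instance_law n p M x y) (\<lambda>(\<beta>, \<gamma>, A). \<Prod>e\<in>\<Omega>. g e (\<beta> e) (\<gamma> e) (A e))"
    unfolding pattern_product[OF z] g_def ..
  also have "\<dots> = (\<Prod>e\<in>\<Omega>. g2 e True * x' e + g2 e False * (1 - x' e))"
    unfolding instance_law_def
    by (simp add: expectation_pair_pmf_finite finite_set_random_comparisons finite_set_random_admissibility EA
          E\<gamma> E\<beta> del: integral_map_pmf)
  also have "\<dots> = (\<Prod>e\<in>M. g2 e True * x' e + g2 e False * (1 - x' e))
      * (\<Prod>e\<in>\<Omega> - M. g2 e True * x' e + g2 e False * (1 - x' e))"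
    using prod.subset_diff[OF M_subset, of "\<lambda>e. g2 e True * x' e + g2 e False * (1 - x' e)"]
    by (simp add: mult.commute)
  also have "(\<Prod>e\<in>M. g2 e True * x' e + g2 e False * (1 - x' e)) = p ^ card M"
    by (simp add: g2_def g1_def g_def x'_def y'_def)
  also have "(\<Prod>e\<in>\<Omega> - M. g2 e True * x' e + g2 e False * (1 - x' e))
     = (\<Prod>(i, j)\<in>\<Omega> - M. 1 - p * x i * y j + (if i \<in> fst ` M then (z - 1) * p * x i * (1 - y j) else 0))"
  proof (rule prod.cong[OF refl], clarify)
    fix i j assume "(i, j) \<notin> M"
    then show "g2 (i, j) True * x' (i, j) + g2 (i, j) False * (1 - x' (i, j))
        = 1 - p * x i * y j + (if i \<in> fst ` M then (z - 1) * p * x i * (1 - y j) else 0)"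
      by (simp add: g2_def g1_def g_def x'_def y'_def algebra_simps)
  qed
  finally show ?thesis .
qed

definition T :: real where "T = (\<Sum>(i, j)\<in>matched_rows n M. x i * (1 - y j))"

text \<open>Each pair of \<open>M\<close> contributes at most 1 to the full sum. Multiplied by
  \<open>p\<close>, this loss is the source of the factor \<open>exp (p * real n)\<close>.\<close>

lemma sum_pairs_ge: "(\<Sum>(i, j)\<in>\<Omega> - M. x i * y j) \<ge> X * Y - real n"
proof -
  have "(\<Sum>(i, j)\<in>\<Omega>. x i * y j) = X * Y"
    unfolding X_def Y_def by (simp add: sum_product sum.cartesian_product)
  moreover have "(\<Sum>(i, j)\<in>\<Omega>. x i * y j) = (\<Sum>(i, j)\<in>\<Omega> - M. x i * y j) + (\<Sum>(i, j)\<in>M. x i * y j)"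
    by (rule sum.subset_diff[OF M_subset]) simp
  moreover have "(\<Sum>(i, j)\<in>M. x i * y j) \<le> (\<Sum>(i, j)\<in>M. 1)"
    using x y by (intro sum_mono) (auto intro!: mult_le_one simp: less_imp_le)
  moreover have "(\<Sum>(i, j)\<in>M. 1) \<le> real n" using card_M_le by simp
  ultimately show ?thesis by linarith
qed

text \<open>Markov's inequality for \<open>z ^ rank\<close> on the event of stability. Values
  \<open>z \<ge> 1\<close> serve the upper tail, \<open>z \<le> 1\<close> the lower tail, and
  \<open>z = 1\<close> with \<open>t = 0\<close> gives bare stability.\<close>

lemma prob_pattern_tail:
  assumes z: "z > 0"
  shows "measure_pmf.prob (instance_law n p M x y)
      {(\<beta>, \<gamma>, A). pattern_stable n M \<beta> \<gamma> A \<and>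
         (1 \<le> z \<and> t \<le> real (pattern_rank n M \<beta> A) \<or> z \<le> 1 \<and> real (pattern_rank n M \<beta> A) \<le> t)}
    \<le> z powr (- t) * (p ^ card M * exp (p * real n - p * X * Y + (z - 1) * p * T))"
proof -
  let ?L = "instance_law n p M x y"
  let ?h = "\<lambda>(i, j). 1 - p * x i * y j + (if i \<in> fst ` M then (z - 1) * p * x i * (1 - y j) else 0)"
  have fin: "integrable (measure_pmf ?L) f" for f :: "_ \<Rightarrow> real"
    by (intro integrable_measure_pmf_finite finite_set_instance_law)
  have "measure_pmf.prob ?L {(\<beta>, \<gamma>, A). pattern_stable n M \<beta> \<gamma> A \<and>
         (1 \<le> z \<and> t \<le> real (pattern_rank n M \<beta> A) \<or> z \<le> 1 \<and> real (pattern_rank n M \<beta> A) \<le> t)}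
     \<le> measure_pmf.expectation ?L (\<lambda>\<omega>. z powr (- t) * (case \<omega> of (\<beta>, \<gamma>, A) \<Rightarrow>
          of_bool (pattern_stable n M \<beta> \<gamma> A) * z ^ pattern_rank n M \<beta> A))"
    unfolding prob_eq_expectation_pmf
  proof (rule integral_mono[OF fin fin])
    fix \<omega> :: "(nat \<times> nat \<Rightarrow> bool) \<times> (nat \<times> nat \<Rightarrow> bool) \<times> (nat \<times> nat \<Rightarrow> bool)"
    obtain \<beta> \<gamma> A where \<omega>: "\<omega> = (\<beta>, \<gamma>, A)" by (cases \<omega>)
    have "z powr (- t) * z ^ pattern_rank n M \<beta> A = z powr (real (pattern_rank n M \<beta> A) - t)"
      using z by (simp add: powr_diff powr_realpow powr_minus field_simps)
    moreover have "z powr (real (pattern_rank n M \<beta> A) - t) \<ge> 1"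
      if "1 \<le> z \<and> t \<le> real (pattern_rank n M \<beta> A) \<or> z \<le> 1 \<and> real (pattern_rank n M \<beta> A) \<le> t"
      using that
    proof
      assume "1 \<le> z \<and> t \<le> real (pattern_rank n M \<beta> A)"
      then show ?thesis by (intro ge_one_powr_ge_zero) auto
    next
      assume "z \<le> 1 \<and> real (pattern_rank n M \<beta> A) \<le> t"
      then show ?thesis using z powr_mono'[of "real (pattern_rank n M \<beta> A) - t" 0 z] by simp
    qed
    ultimately show "of_bool (\<omega> \<in> {(\<beta>, \<gamma>, A). pattern_stable n M \<beta> \<gamma> A \<and>
         (1 \<le> z \<and> t \<le> real (pattern_rank n M \<beta> A) \<or> z \<le> 1 \<and> real (pattern_rank n M \<beta> A) \<le> t)})
       \<le> z powr (- t) * (case \<omega> of (\<beta>, \<gamma>, A) \<Rightarrow>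
          of_bool (pattern_stable n M \<beta> \<gamma> A) * z ^ pattern_rank n M \<beta> A)"
      unfolding \<omega> using z by (auto simp: of_bool_def)
  qed
  also have "\<dots> = z powr (- t) * (p ^ card M * prod ?h (\<Omega> - M))"
    using expectation_pattern[OF z] by simp
  also have "\<dots> \<le> z powr (- t) * (p ^ card M * exp (p * real n - p * X * Y + (z - 1) * p * T))"
  proof (intro mult_left_mono)
    have "prod ?h (\<Omega> - M) \<le> (\<Prod>e\<in>\<Omega> - M. exp (?h e - 1))"
    proof (rule prod_mono, intro conjI)
      fix e assume "e \<in> \<Omega> - M"
      show "?h e \<le> exp (?h e - 1)" using exp_ge_add_one_self[of "?h e - 1"] by simp
      obtain i j where e: "e = (i, j)" by (cases e)
      \<comment> \<open>The product can be compared factor by factor only if the factors are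
        nonnegative; even for \<open>z\<close> near 0 they are at least
        \<open>1 - p * x i\<close>.\<close>
      have "p * x i * (1 - y j) \<ge> 0" using p x(1)[of i] y(2)[of j] by (simp add: mult_nonneg_nonneg)
      then have "(z - 1) * (p * x i * (1 - y j)) \<ge> - (p * x i * (1 - y j))"
        using z mult_right_mono[of "-1" "z - 1" "p * x i * (1 - y j)"] by simp
      moreover have "p * x i \<le> 1" using p x(2)[of i] x(1)[of i] by (intro mult_le_one) auto
      moreover have "p * x i * y j \<le> 1" using p x[of i] y[of j] by (intro mult_le_one) (auto simp: less_imp_le)
      ultimately show "0 \<le> ?h e" unfolding e by (auto simp: algebra_simps)
    qed
    also have "\<dots> = exp (\<Sum>e\<in>\<Omega> - M. ?h e - 1)" by (simp add: exp_sum)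
    also have "(\<Sum>e\<in>\<Omega> - M. ?h e - 1)
        = - p * (\<Sum>(i, j)\<in>\<Omega> - M. x i * y j) + (z - 1) * p * T"
    proof -
      have "(\<Sum>e\<in>\<Omega> - M. ?h e - 1) = (\<Sum>e\<in>\<Omega> - M. - p * (case e of (i, j) \<Rightarrow> x i * y j)
          + (z - 1) * p * (if e \<in> matched_rows n M then case e of (i, j) \<Rightarrow> x i * (1 - y j) else 0))"
        by (intro sum.cong) (auto simp: matched_rows_def dest: fst_memI)
      also have "\<dots> = - p * (\<Sum>(i, j)\<in>\<Omega> - M. x i * y j)
          + (z - 1) * p * (\<Sum>e\<in>\<Omega> - M. if e \<in> matched_rows n M then case e of (i, j) \<Rightarrow> x i * (1 - y j) else 0)"
        by (simp only: sum.distrib sum_distrib_left)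
      also have "(\<Sum>e\<in>\<Omega> - M. if e \<in> matched_rows n M then case e of (i, j) \<Rightarrow> x i * (1 - y j) else 0) = T"
      proof -
        have "(\<Omega> - M) \<inter> matched_rows n M = matched_rows n M" by (auto simp: matched_rows_def)
        then show ?thesis unfolding T_def by (subst sum.inter_restrict[symmetric]) simp_all
      qed
      finally show ?thesis .
    qed
    also have "exp \<dots> \<le> exp (p * real n - p * X * Y + (z - 1) * p * T)"
      using mult_left_mono[OF sum_pairs_ge p(1)] by (simp add: algebra_simps)
    finally show "prod ?h (\<Omega> - M) \<le> exp (p * real n - p * X * Y + (z - 1) * p * T)" .
  qed (use p in auto)
  finally show ?thesis .
qed

lemma prob_pattern_stable:
  "measure_pmf.prob (instance_law n p M x y) {(\<beta>, \<gamma>, A). pattern_stable n M \<beta> \<gamma> A}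
    \<le> p ^ card M * exp (p * real n) * exp (- p * X * Y)"
proof -
  have "exp (p * real n) * exp (- p * X * Y) = exp (p * real n - p * X * Y)"
    by (simp flip: exp_add)
  then show ?thesis using prob_pattern_tail[of 1 0] by (simp add: mult.assoc)
qed

lemma sum_matched: "(\<Sum>i\<in>fst ` M. x i) = X - real (n - card M)"
proof -
  have "X = (\<Sum>i\<in>{..<n} - fst ` M. x i) + (\<Sum>i\<in>fst ` M. x i)"
    unfolding X_def by (rule sum.subset_diff[OF fst_M]) simp
  also have "(\<Sum>i\<in>{..<n} - fst ` M. x i) = real (card ({..<n} - fst ` M))"
    using x(3) by simp
  also have "card ({..<n} - fst ` M) = n - card M"
    using fst_M finite_M card_image[OF inj_fst] by (simp add: card_Diff_subset)
  finally show ?thesis by simp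
qed

text \<open>Over the full rows of the matched men the sum factors into
  \<open>(X - real (n - card M)) * (real n - Y)\<close>, since every unmatched man has position 1.
  The pairs of \<open>M\<close> account for at most \<open>n\<close> of it.\<close>

lemma T_upper: "T \<le> real n * X" and T_lower: "(X - real (n - card M)) * (real n - Y) - real n \<le> T"
proof -
  let ?R = "fst ` M \<times> {..<n}"
  let ?f = "\<lambda>(i, j). x i * (1 - y j)"
  have f0: "?f e \<ge> 0" for e using x y by (cases e) (simp add: less_imp_le)
  have fin: "finite ?R" using finite_M by simp
  have R: "sum ?f ?R = (X - real (n - card M)) * (real n - Y)"
    unfolding sum_matched[symmetric] Y_def
    by (subst sum.cartesian_product[symmetric]) (simp add: sum_distrib_left [symmetric] sum_subtractf sum_distrib_right)
  have sub: "matched_rows n M = ?R - M" using fst_M by (auto simp: matched_rows_def dest: fst_memI)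
  have MR: "M \<subseteq> ?R" using M_subset by force
  have Tdiff: "sum ?f ?R = T + sum ?f M"
    unfolding T_def sub by (rule sum.subset_diff[OF MR fin])
  have "sum ?f M \<le> (\<Sum>(i, j)\<in>M. 1)"
    using x y by (intro sum_mono) (auto intro!: mult_le_one simp: less_imp_le)
  also have "\<dots> \<le> real n" using card_M_le by simp
  finally show "(X - real (n - card M)) * (real n - Y) - real n \<le> T" using Tdiff R by linarith
  have "sum ?f M \<ge> 0" by (intro sum_nonneg f0)
  then have "T \<le> (X - real (n - card M)) * (real n - Y)" using Tdiff R by linarith
  also have "\<dots> \<le> X * real n"
  proof (rule mult_mono)
    show "0 \<le> X" unfolding X_def using x by (intro sum_nonneg) (simp add: less_imp_le)
    show "real n - Y \<le> real n" using y by (simp add: Y_def sum_nonneg less_imp_le)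
    have "Y \<le> (\<Sum>j<n. 1)" unfolding Y_def by (intro sum_mono y)
    then show "0 \<le> real n - Y" by simp
  qed auto
  finally show "T \<le> real n * X" by (simp add: mult.commute)
qed

text \<open>
  Under the tilted measure the rank of a matching with \<open>X\<close> and \<open>Y\<close> close to \<open>n / r\<close>
  has mean about \<open>p n X\<close>, that is \<open>n r\<close>; hence the exponential (Chernoff) bound for its tails.
\<close>

lemma prob_pattern_tails_small:
  fixes r \<tau> :: real
  defines "r \<equiv> sqrt (p * real n)"
  assumes n: "n > 0" and p0: "p > 0"
    and \<tau>: "0 < \<tau>" "\<tau> \<le> 1 / 8" and r: "2 \<le> \<tau> * r" "r \<le> \<tau> * real n"
    and X: "\<bar>X * r / real n - 1\<bar> \<le> \<tau>" and Y: "\<bar>Y * r / real n - 1\<bar> \<le> \<tau>"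
    and k: "real (n - card M) \<le> \<tau> * real n / r"
  shows "measure_pmf.prob (instance_law n p M x y)
      {(\<beta>, \<gamma>, A). pattern_stable n M \<beta> \<gamma> A \<and>
         \<not> ((1 - 8 * \<tau>) * (real n * r) \<le> real (card M + pattern_rank n M \<beta> A) \<and>
            real (card M + pattern_rank n M \<beta> A) \<le> (1 + 8 * \<tau>) * (real n * r))}
    \<le> p ^ card M * exp (p * real n) * exp (- p * X * Y) * (2 * exp (- \<tau> * real n))"
proof -
  let ?L = "instance_law n p M x y"
  have r0: "r > 0" using n p0 by (simp add: r_def)
  have r2: "p * real n = r ^ 2" using n p0 by (simp add: r_def)
  have r16: "r \<ge> 16"
  proof -
    have "\<tau> * r \<le> 1 / 8 * r" using \<tau> r0 by (intro mult_right_mono) auto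
    then show ?thesis using r by simp
  qed
  have rn: "r \<le> real n"
  proof -
    have "\<tau> * real n \<le> 1 * real n" using \<tau> by (intro mult_right_mono) auto
    then show ?thesis using r by simp
  qed
  have Xb: "(1 - \<tau>) * (real n / r) \<le> X" "X \<le> (1 + \<tau>) * (real n / r)"
    using X r0 n by (auto simp: abs_le_iff field_simps)
  have Yb: "Y \<le> \<tau> * real n"
  proof -
    have "Y \<le> (1 + \<tau>) * (real n / r)" using Y r0 n by (auto simp: abs_le_iff field_simps)
    also have "\<dots> \<le> 2 * (real n / r)" using \<tau> n r0 by (intro mult_right_mono) auto
    also have "\<dots> \<le> \<tau> * real n" using r r0 n by (simp add: field_simps)
    finally show ?thesis .
  qed
  \<comment> \<open>The total rank exceeds the pattern rank by \<open>card M\<close>, which is at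
    most \<open>n\<close>; this explains the subtraction in \<open>t1\<close>. In the lower tail
    \<open>card M \<ge> 0\<close> suffices.\<close>
  define t1 where "t1 = (1 + 8 * \<tau>) * (real n * r) - real n"
  define t2 where "t2 = (1 - 8 * \<tau>) * (real n * r)"
  define C where "C = p ^ card M * exp (p * real n) * exp (- p * X * Y)"
  have C: "p ^ card M * exp (p * real n - p * X * Y + s) = C * exp s" for s
    by (simp add: C_def mult.assoc flip: exp_add)
  have powr_exp: "z powr (- t) * (C * exp s) = C * exp (s - t * ln z)" if "z > 0" for z t s
    using that by (simp add: powr_def exp_diff exp_minus field_simps)
  have upper: "measure_pmf.prob ?L {(\<beta>, \<gamma>, A). pattern_stable n M \<beta> \<gamma> A \<and> t1 \<le> real (pattern_rank n M \<beta> A)}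
      \<le> C * exp (- \<tau> * real n)"
  proof -
    have "measure_pmf.prob ?L {(\<beta>, \<gamma>, A). pattern_stable n M \<beta> \<gamma> A \<and> t1 \<le> real (pattern_rank n M \<beta> A)}
        \<le> measure_pmf.prob ?L {(\<beta>, \<gamma>, A). pattern_stable n M \<beta> \<gamma> A \<and>
         (1 \<le> 1 + \<tau> \<and> t1 \<le> real (pattern_rank n M \<beta> A) \<or> 1 + \<tau> \<le> 1 \<and> real (pattern_rank n M \<beta> A) \<le> t1)}"
      using \<tau> by (intro measure_pmf.finite_measure_mono) auto
    also have "\<dots> \<le> (1 + \<tau>) powr (- t1) * (C * exp (\<tau> * p * T))"
      using prob_pattern_tail[of "1 + \<tau>" t1] \<tau> unfolding C by simp
    also have "\<dots> = C * exp (\<tau> * p * T - t1 * ln (1 + \<tau>))"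
      using \<tau> by (intro powr_exp) simp
    also have "\<dots> \<le> C * exp (- \<tau> * real n)"
    proof -
      have "\<tau> * (p * T) \<le> \<tau> * ((1 + \<tau>) * (real n * r))"
      proof (rule mult_left_mono)
        have "p * T \<le> p * (real n * X)" using T_upper p0 by (intro mult_left_mono) auto
        also have "\<dots> = r ^ 2 * X" using r2 by (simp add: mult.assoc)
        also have "\<dots> \<le> r ^ 2 * ((1 + \<tau>) * (real n / r))" using Xb by (intro mult_left_mono) auto
        also have "\<dots> = (1 + \<tau>) * (real n * r)" using r0 by (simp add: power2_eq_square field_simps)
        finally show "p * T \<le> (1 + \<tau>) * (real n * r)" .
      qed (use \<tau> in auto)
      moreover have "t1 * ln (1 + \<tau>) \<ge> t1 * (\<tau> - \<tau>\<^sup>2)"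
      proof (rule mult_left_mono)
        show "\<tau> - \<tau>\<^sup>2 \<le> ln (1 + \<tau>)" using ln_one_plus_pos_lower_bound[of \<tau>] \<tau> by simp
        have "real n * 1 \<le> real n * r" using r16 by (intro mult_left_mono) auto
        moreover have "\<tau> * (real n * r) \<ge> 0" using \<tau> r0 by simp
        ultimately show "0 \<le> t1" unfolding t1_def by (simp add: algebra_simps)
      qed
      moreover have "\<tau> * ((1 + \<tau>) * (real n * r)) - t1 * (\<tau> - \<tau>\<^sup>2) \<le> - \<tau> * real n"
      proof -
        \<comment> \<open>This is the claim divided by \<open>\<tau> * real n\<close>. The slack
          \<open>8 * \<tau>\<close> exceeds the relative errors \<open>\<tau>\<close> of the mean
          and \<open>\<tau>\<close> of the logarithm by about \<open>6 * \<tau>\<close>, and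
          \<open>2 \<le> \<tau> * r\<close> makes the remainder pay for the term \<open>n\<close> in
          \<open>t1\<close>.\<close>
        have "(1 + \<tau>) * r - (1 - \<tau>) * ((1 + 8 * \<tau>) * r - 1) \<le> -1"
        proof -
          have eq: "(1 + \<tau>) * r - (1 - \<tau>) * ((1 + 8 * \<tau>) * r - 1)
              = (8 * \<tau> - 6) * (\<tau> * r) + 1 - \<tau>" by (simp add: algebra_simps)
          have "(8 * \<tau> - 6) * (\<tau> * r) \<le> (8 * \<tau> - 6) * 2"
            using \<tau> r by (intro mult_left_mono_neg) auto
          also have "\<dots> \<le> -2" using \<tau> by simp
          finally show ?thesis unfolding eq using \<tau>(1) by simp
        qed
        from mult_left_mono[OF this, of "\<tau> * real n"] \<tau> show ?thesis
          by (simp add: t1_def power2_eq_square algebra_simps)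
      qed
      ultimately have "\<tau> * p * T - t1 * ln (1 + \<tau>) \<le> - \<tau> * real n" by (simp add: mult.assoc)
      then show ?thesis using p by (intro mult_left_mono) (auto simp: C_def)
    qed
    finally show ?thesis .
  qed
  have lower: "measure_pmf.prob ?L {(\<beta>, \<gamma>, A). pattern_stable n M \<beta> \<gamma> A \<and> real (pattern_rank n M \<beta> A) \<le> t2}
      \<le> C * exp (- \<tau> * real n)"
  proof -
    have "measure_pmf.prob ?L {(\<beta>, \<gamma>, A). pattern_stable n M \<beta> \<gamma> A \<and> real (pattern_rank n M \<beta> A) \<le> t2}
        \<le> measure_pmf.prob ?L {(\<beta>, \<gamma>, A). pattern_stable n M \<beta> \<gamma> A \<and>
         (1 \<le> 1 - \<tau> \<and> t2 \<le> real (pattern_rank n M \<beta> A) \<or> 1 - \<tau> \<le> 1 \<and> real (pattern_rank n M \<beta> A) \<le> t2)}"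
      using \<tau> by (intro measure_pmf.finite_measure_mono) auto
    also have "\<dots> \<le> (1 - \<tau>) powr (- t2) * (C * exp (- \<tau> * p * T))"
      using prob_pattern_tail[of "1 - \<tau>" t2] \<tau> C[of "- \<tau> * p * T"] by simp
    also have "\<dots> = C * exp ((- \<tau> * p * T) - t2 * ln (1 - \<tau>))"
      using \<tau> by (intro powr_exp) simp
    also have "\<dots> \<le> C * exp (- \<tau> * real n)"
    proof -
      have "p * T \<ge> (1 - 3 * \<tau>) * (real n * r) - r ^ 2"
      proof -
        have "(1 - 3 * \<tau>) * (real n * (real n / r)) \<le> ((1 - 2 * \<tau>) * (real n / r)) * ((1 - \<tau>) * real n)"
        proof -
          have "(1 - 3 * \<tau>) \<le> (1 - 2 * \<tau>) * (1 - \<tau>)" by (simp add: algebra_simps)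
          from mult_right_mono[OF this, of "real n * (real n / r)"] show ?thesis
            using r0 by (simp add: mult_ac)
        qed
        also have "\<dots> \<le> (X - real (n - card M)) * (real n - Y)"
        proof (rule mult_mono)
          show Xk: "(1 - 2 * \<tau>) * (real n / r) \<le> X - real (n - card M)"
          proof -
            have "(1 - 2 * \<tau>) * (real n / r) = (1 - \<tau>) * (real n / r) - \<tau> * real n / r"
              by (simp add: left_diff_distrib diff_divide_distrib)
            then show ?thesis using Xb(1) k by linarith
          qed
          show "(1 - \<tau>) * real n \<le> real n - Y" using Yb by (simp add: algebra_simps)
          then show "0 \<le> (1 - \<tau>) * real n" using \<tau> by simp
          have "0 \<le> (1 - 2 * \<tau>) * (real n / r)" using \<tau> r0 by simp
          then show "0 \<le> X - real (n - card M)" using Xk by linarith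
        qed
        finally have "(1 - 3 * \<tau>) * (real n * (real n / r)) - real n \<le> T" using T_lower by linarith
        from mult_left_mono[OF this, of p] p0
        have "(1 - 3 * \<tau>) * ((p * real n) * (real n / r)) - p * real n \<le> p * T" by (simp add: algebra_simps)
        moreover have "r\<^sup>2 * (real n / r) = real n * r" using r0 by (simp add: power2_eq_square)
        ultimately show ?thesis by (simp only: r2)
      qed
      then have "\<tau> * (p * T) \<ge> \<tau> * ((1 - 3 * \<tau>) * (real n * r) - r ^ 2)"
        using \<tau> by (intro mult_left_mono) auto
      moreover have "t2 * ln (1 - \<tau>) \<ge> t2 * (- \<tau> - 2 * \<tau>\<^sup>2)"
        using ln_one_minus_pos_lower_bound[of \<tau>] \<tau> r0 by (intro mult_left_mono) (auto simp: t2_def)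
      moreover have "\<tau> * ((1 - 3 * \<tau>) * (real n * r) - r ^ 2) + t2 * (- \<tau> - 2 * \<tau>\<^sup>2) \<ge> \<tau> * real n"
      proof -
        have a: "\<tau> * (real n * r) \<ge> 2 * real n" using mult_left_mono[OF r(1), of "real n"] by (simp add: mult_ac)
        have b: "r ^ 2 \<le> \<tau> * (real n * r)"
          using mult_right_mono[OF r(2), of r] r0 by (simp add: power2_eq_square mult_ac)
        \<comment> \<open>Of the slack \<open>8 * \<tau>\<close> the mean uses
          \<open>3 * \<tau>\<close> and the logarithm \<open>2 * \<tau>\<close>. One third of what
          remains pays for \<open>r ^ 2\<close> by \<open>b\<close>, the rest for \<open>n\<close>
          by \<open>a\<close>.\<close>
        have "(1 - 3 * \<tau>) * (real n * r) - r ^ 2 - (1 - 8 * \<tau>) * (real n * r) * (1 + 2 * \<tau>)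
            = 3 * (\<tau> * (real n * r)) + 16 * \<tau> * \<tau> * (real n * r) - r ^ 2" by (simp add: algebra_simps)
        moreover have "16 * \<tau> * \<tau> * (real n * r) \<ge> 0" using \<tau> r0 by simp
        ultimately have "(1 - 3 * \<tau>) * (real n * r) - r ^ 2 - (1 - 8 * \<tau>) * (real n * r) * (1 + 2 * \<tau>) \<ge> real n"
          using a b by linarith
        from mult_left_mono[OF this, of \<tau>] \<tau> show ?thesis
          by (simp add: t2_def power2_eq_square algebra_simps)
      qed
      ultimately have "(- \<tau> * p * T) - t2 * ln (1 - \<tau>) \<le> - \<tau> * real n" by (simp add: mult.assoc)
      then show ?thesis using p by (intro mult_left_mono) (auto simp: C_def)
    qed
    finally show ?thesis .
  qed
  have "measure_pmf.prob ?L
      {(\<beta>, \<gamma>, A). pattern_stable n M \<beta> \<gamma> A \<and>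
         \<not> ((1 - 8 * \<tau>) * (real n * r) \<le> real (card M + pattern_rank n M \<beta> A) \<and>
            real (card M + pattern_rank n M \<beta> A) \<le> (1 + 8 * \<tau>) * (real n * r))}
    \<le> measure_pmf.prob ?L
      ({(\<beta>, \<gamma>, A). pattern_stable n M \<beta> \<gamma> A \<and> t1 \<le> real (pattern_rank n M \<beta> A)} \<union>
       {(\<beta>, \<gamma>, A). pattern_stable n M \<beta> \<gamma> A \<and> real (pattern_rank n M \<beta> A) \<le> t2})"
    using card_M_le by (intro measure_pmf.finite_measure_mono) (auto simp: t1_def t2_def)
  also have "\<dots> \<le> C * exp (- \<tau> * real n) + C * exp (- \<tau> * real n)"
    using upper lower by (intro order_trans[OF measure_subadditive] add_mono) auto
  finally show ?thesis by (simp add: C_def mult_ac)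
qed

end

subsection \<open>Averaging over the positions\<close>

text \<open>The Laplace transform at \<open>t\<close> of the uniform distribution on [0, 1].\<close>

definition exp_average :: "real \<Rightarrow> real" where
  "exp_average t = (1 - exp (- t)) / t"

lemma exp_average_pos: "t > 0 \<Longrightarrow> exp_average t > 0"
  by (simp add: exp_average_def)

lemma exp_average_le: "t > 0 \<Longrightarrow> exp_average t \<le> 1 / t"
  by (simp add: exp_average_def divide_right_mono)

lemma exp_average_le_1: "t > 0 \<Longrightarrow> exp_average t \<le> 1"
  using exp_ge_add_one_self[of "- t"] by (simp add: exp_average_def)

lemma exp_average_antimono:
  assumes "0 < s" "s \<le> t"
  shows "exp_average t \<le> exp_average s"
proof (rule DERIV_nonpos_imp_nonincreasing[OF assms(2)])
  fix x assume x: "s \<le> x" "x \<le> t"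
  then have x0: "x > 0" using assms by simp
  have "(exp_average has_real_derivative (exp (- x) * x - (1 - exp (- x))) / (x * x)) (at x)"
    unfolding exp_average_def[abs_def] using x0 by (auto intro!: derivative_eq_intros)
  moreover have "exp (- x) * (x + 1) \<le> exp (- x) * exp x"
    using exp_ge_add_one_self[of x] by (intro mult_left_mono) (auto simp: add.commute)
  then have "exp (- x) * x - (1 - exp (- x)) \<le> 0" by (simp add: algebra_simps flip: exp_add)
  then have "(exp (- x) * x - (1 - exp (- x))) / (x * x) \<le> 0" using x0 by (simp add: divide_nonpos_pos)
  ultimately show "\<exists>y. (exp_average has_real_derivative y) (at x) \<and> y \<le> 0" by blast
qed

text \<open>The grid consists of right endpoints and the exponential decreases, so the average stays
  below the integral for every \<open>N\<close>. The sum itself is geometric.\<close>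

lemma expectation_grid_exp:
  assumes N: "N > 0" and t: "t > 0"
  shows "measure_pmf.expectation (uniform_grid N) (\<lambda>x. exp (- t * x)) \<le> exp_average t"
proof -
  define q where "q = exp (- t / real N)"
  define S where "S = (\<Sum>m=1..N. q ^ m)"
  have q0: "q > 0" by (simp add: q_def)
  have gp: "(1 - q) * (\<Sum>m=1..K. q ^ m) = q * (1 - q ^ K)" for K
  proof (induction K)
    case (Suc K)
    have "(1 - q) * (\<Sum>m=1..Suc K. q ^ m) = (1 - q) * (\<Sum>m=1..K. q ^ m) + (1 - q) * q ^ Suc K"
      by (simp add: distrib_left)
    also have "\<dots> = q * (1 - q ^ Suc K)" unfolding Suc by (simp add: algebra_simps)
    finally show ?case .
  qed simp
  have qN: "q ^ N = exp (- t)" using N by (simp add: q_def flip: exp_of_nat_mult)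
  have "(\<Sum>m=1..N. exp (- t * (real m / real N))) = S"
    unfolding S_def q_def by (intro sum.cong) (auto simp flip: exp_of_nat_mult)
  then have E: "measure_pmf.expectation (uniform_grid N) (\<lambda>x. exp (- t * x)) = S / real N"
    using N by (simp add: expectation_uniform_grid)
  have "t / real N \<le> exp (t / real N) - 1"
    using exp_ge_add_one_self[of "t / real N"] by linarith
  then have "q * (t / real N) \<le> q * (exp (t / real N) - 1)"
    using q0 by (intro mult_left_mono) auto
  also have "\<dots> = 1 - q" by (simp add: q_def algebra_simps flip: exp_add)
  finally have "(q * (t / real N)) * S \<le> (1 - q) * S"
    using q0 by (intro mult_right_mono) (auto simp: S_def intro!: sum_nonneg)
  also have "\<dots> = q * (1 - exp (- t))" unfolding S_def gp qN ..
  finally have "q * ((t / real N) * S) \<le> q * (1 - exp (- t))" by (simp add: mult.assoc)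
  then have "(t / real N) * S \<le> 1 - exp (- t)" using q0 by (rule mult_left_le_imp_le)
  then show ?thesis unfolding E exp_average_def using t N by (simp add: field_simps)
qed

lemma expectation_positions_exp:
  assumes N: "N > 0" and t: "t > 0" and I: "I \<subseteq> {..<n}"
  shows "measure_pmf.expectation (random_positions n I N) (\<lambda>x. exp (- t * (\<Sum>i<n. x i)))
    \<le> exp (- t * real (n - card I)) * exp_average t ^ card I"
proof -
  have finI: "finite I" using I finite_subset by auto
  have "measure_pmf.expectation (random_positions n I N) (\<lambda>x. exp (- t * (\<Sum>i<n. x i)))
      = measure_pmf.expectation (random_positions n I N) (\<lambda>x. \<Prod>i<n. exp (- t * x i))"
    by (simp add: sum_distrib_left exp_sum)
  also have "\<dots> = (\<Prod>i<n. measure_pmf.expectation (if i \<in> I then uniform_grid N else return_pmf 1) (\<lambda>x. exp (- t * x)))"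
    unfolding random_positions_def
    by (rule expectation_prod_Pi_pmf)
       (use N in \<open>auto simp: finite_set_uniform_grid intro!: integrable_measure_pmf_finite\<close>)
  also have "\<dots> \<le> (\<Prod>i<n. if i \<in> I then exp_average t else exp (- t))"
    using expectation_grid_exp[OF N t] by (intro prod_mono) (auto intro!: Bochner_Integration.integral_nonneg)
  also have "\<dots> = exp_average t ^ card I * exp (- t) ^ card ({..<n} - I)"
  proof -
    have "{..<n} \<inter> {i. i \<in> I} = I" "{..<n} \<inter> - {i. i \<in> I} = {..<n} - I" using I by auto
    then show ?thesis by (subst prod.If_cases) auto
  qed
  also have "exp (- t) ^ card ({..<n} - I) = exp (- t * real (n - card I))"
    using I finI by (simp add: card_Diff_subset mult.commute flip: exp_of_nat_mult)
  finally show ?thesis by (simp add: mult.commute)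
qed

text \<open>
  A sum of exponential tilts over a net of \<open>n\<^sup>2\<close> parameters. Its expectation is polynomial in \<open>n\<close>,
  while it dominates the optimal tilt for every value of \<open>X\<close>; this replaces integration against the
  density of a sum of uniform variables.
\<close>

definition tilt_sum :: "nat \<Rightarrow> nat \<Rightarrow> real \<Rightarrow> real" where
  "tilt_sum n k X = (\<Sum>j=1..n\<^sup>2. exp (1 - real j / real n * (X - real k)) / exp_average (real j / real n) ^ (n - k))"

lemma tilt_sum_nonneg: "tilt_sum n k X \<ge> 0"
  unfolding tilt_sum_def exp_average_def by (intro sum_nonneg divide_nonneg_nonneg zero_le_power) auto

text \<open>Each summand is normalised by the bound on the Laplace transform of X at its own tilt,
  so its mean is at most e.\<close>

lemma expectation_tilt_sum:
  assumes N: "N > 0" and I: "I \<subseteq> {..<n}" and n: "n > 0"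
  shows "measure_pmf.expectation (random_positions n I N) (\<lambda>x. tilt_sum n (n - card I) (\<Sum>i<n. x i))
    \<le> exp 1 * real n ^ 2"
proof -
  let ?k = "n - card I"
  have cI: "card I \<le> n" using card_mono[OF _ I] by simp
  have int: "integrable (measure_pmf (random_positions n I N)) f" for f :: "_ \<Rightarrow> real"
    using N by (intro integrable_measure_pmf_finite finite_set_random_positions)
  have "measure_pmf.expectation (random_positions n I N) (\<lambda>x. tilt_sum n ?k (\<Sum>i<n. x i))
     = (\<Sum>j=1..n\<^sup>2. measure_pmf.expectation (random_positions n I N) (\<lambda>x.
         exp (1 + real j / real n * real ?k) / exp_average (real j / real n) ^ card I * exp (- (real j / real n) * (\<Sum>i<n. x i))))"
  proof -
    have "exp (1 - c * (S - real ?k)) / exp_average c ^ (n - ?k)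
        = exp (1 + c * real ?k) / exp_average c ^ card I * exp (- c * S)" for c S
    proof -
      have "exp (1 - c * (S - real ?k)) = exp (1 + c * real ?k) * exp (- c * S)"
        by (subst exp_add[symmetric]) (simp add: right_diff_distrib)
      then show ?thesis using cI by simp
    qed
    then show ?thesis unfolding tilt_sum_def
      by (simp only:) (rule Bochner_Integration.integral_sum, rule int)
  qed
  also have "\<dots> \<le> (\<Sum>j=1..n\<^sup>2. exp 1)"
  proof (rule sum_mono)
    fix j assume j: "j \<in> {1..n\<^sup>2}"
    define l where "l = real j / real n"
    have l: "l > 0" using j n by (simp add: l_def)
    have pos: "exp_average l ^ card I > 0" using l by (simp add: exp_average_pos)
    have "measure_pmf.expectation (random_positions n I N) (\<lambda>x.
         exp (1 + l * real ?k) / exp_average l ^ card I * exp (- l * (\<Sum>i<n. x i)))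
       = exp (1 + l * real ?k) / exp_average l ^ card I
         * measure_pmf.expectation (random_positions n I N) (\<lambda>x. exp (- l * (\<Sum>i<n. x i)))"
      by simp
    also have "\<dots> \<le> exp (1 + l * real ?k) / exp_average l ^ card I * (exp (- l * real ?k) * exp_average l ^ card I)"
      using expectation_positions_exp[OF N l I] pos by (intro mult_left_mono) auto
    also have "\<dots> = exp 1" using exp_average_pos[OF l] by (simp add: exp_add exp_minus)
    finally show "measure_pmf.expectation (random_positions n I N) (\<lambda>x.
         exp (1 + real j / real n * real ?k) / exp_average (real j / real n) ^ card I * exp (- (real j / real n) * (\<Sum>i<n. x i))) \<le> exp 1"
      unfolding l_def .
  qed
  also have "\<dots> = exp 1 * real n ^ 2" by simp
  finally show ?thesis .
qed

text \<open>A single summand, with tilt just above l = n / X, is enough. With this tilt,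
  \<open>exp (l * X)\<close> is exp n and 1 / l is X / n; these later cancel against the factorial
  and the powers of X in the average over y.\<close>

lemma tilt_sum_ge:
  assumes n: "n > 0" and X: "1 \<le> X" "X \<le> real n"
  shows "1 \<le> tilt_sum n k X * (exp (real n / X * (X - real k)) * exp_average (real n / X) ^ (n - k))"
proof -
  define l where "l = real n / X"
  have l: "1 \<le> l" "l \<le> real n" using X n by (auto simp: l_def field_simps)
  \<comment> \<open>Rounding up goes the right way because \<open>exp_average\<close> decreases. The
    error 1 / n in the tilt, times \<open>X - real k \<le> n\<close>, costs at most a factor e,
    which the 1 in the exponent of \<open>tilt_sum\<close> repays.\<close>
  define j where "j = nat \<lceil>real n * l\<rceil>"
  have j_ge: "real n * l \<le> real j" unfolding j_def by linarith
  have j_lt: "real j < real n * l + 1"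
  proof -
    have "real n * l \<ge> 0" using l by simp
    then show ?thesis unfolding j_def by linarith
  qed
  have j1: "1 \<le> j"
  proof -
    have "real n * l > 0" using l n by simp
    then show ?thesis using j_ge by linarith
  qed
  have jn: "j \<le> n\<^sup>2"
  proof -
    have "real n * l \<le> real (n\<^sup>2)" using l n by (simp add: power2_eq_square)
    then have "\<lceil>real n * l\<rceil> \<le> int (n\<^sup>2)" by (simp add: ceiling_le_iff)
    then show ?thesis unfolding j_def by linarith
  qed
  define l0 where "l0 = real j / real n"
  have l0: "l \<le> l0" "l0 - l \<le> 1 / real n"
  proof -
    show "l \<le> l0" using j_ge n by (simp add: l0_def field_simps)
    have "l0 \<le> (real n * l + 1) / real n" unfolding l0_def using j_lt by (intro divide_right_mono) auto
    then show "l0 - l \<le> 1 / real n" using n by (simp add: add_divide_distrib)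
  qed
  have "(l0 - l) * (X - real k) \<le> 1"
  proof -
    have "(l0 - l) * (X - real k) \<le> (l0 - l) * real n"
      using l0 X by (intro mult_left_mono) auto
    also have "\<dots> \<le> 1 / real n * real n" using l0 by (intro mult_right_mono) auto
    finally show ?thesis using n by simp
  qed
  then have "exp (- (l * (X - real k))) \<le> exp (1 - l0 * (X - real k))" by (simp add: algebra_simps)
  moreover have "exp_average l0 ^ (n - k) \<le> exp_average l ^ (n - k)"
    using l l0 exp_average_antimono[of l l0] exp_average_pos[of l0] by (intro power_mono) auto
  moreover have pos: "exp_average l0 ^ (n - k) > 0" "exp_average l ^ (n - k) > 0"
    using l l0 by (auto intro!: zero_less_power exp_average_pos)
  ultimately have "exp (- (l * (X - real k))) / exp_average l ^ (n - k)
      \<le> exp (1 - l0 * (X - real k)) / exp_average l0 ^ (n - k)"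
    by (intro frac_le) auto
  also have "\<dots> \<le> tilt_sum n k X"
    unfolding tilt_sum_def l0_def using j1 jn
    by (intro member_le_sum[of j]) (auto simp: exp_average_def)
  finally have "exp (- (l * (X - real k))) / exp_average l ^ (n - k) * (exp (l * (X - real k)) * exp_average l ^ (n - k))
      \<le> tilt_sum n k X * (exp (l * (X - real k)) * exp_average l ^ (n - k))"
    using pos by (intro mult_right_mono) auto
  moreover have "exp (- (l * (X - real k))) / exp_average l ^ (n - k) * (exp (l * (X - real k)) * exp_average l ^ (n - k)) = 1"
    using exp_average_pos[of l] l by (simp add: exp_minus)
  ultimately show ?thesis by (simp add: l_def)
qed

text \<open>Stirling's formula up to a linear factor, by induction from (1 - 1 / (l + 1))^(l + 1)
  \<le> 1 / e. The factor \<open>l + 1\<close> rather than \<open>l\<close> admits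
  \<open>l = 0\<close>.\<close>

lemma fact_le_exp: "fact l \<le> exp 1 * (real l + 1) * (real l ^ l * exp (- real l))"
proof (cases "l = 0")
  case False
  then have "l \<ge> 1" by simp
  then have "fact l \<le> exp 1 * real l * (real l ^ l * exp (- real l))"
  proof (induction l rule: dec_induct)
    case (step l)
    have l: "real l > 0" using step by simp
    have "real l / real (Suc l) = 1 + - (1 / real (Suc l))" using l by (simp add: field_simps)
    also have "\<dots> \<le> exp (- (1 / real (Suc l)))" by (rule exp_ge_add_one_self)
    finally have "(real l / real (Suc l)) ^ Suc l \<le> exp (- (1 / real (Suc l))) ^ Suc l"
      by (intro power_mono) auto
    also have "\<dots> = exp (- 1)" by (subst exp_of_nat_mult[symmetric]) simp
    finally have key: "real l ^ Suc l \<le> exp (- 1) * real (Suc l) ^ Suc l"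
      by (simp add: power_divide field_simps del: of_nat_Suc power_Suc)
    have "fact (Suc l) = real (Suc l) * fact l" by simp
    also have "\<dots> \<le> real (Suc l) * (exp 1 * real l * (real l ^ l * exp (- real l)))"
      using step by (intro mult_left_mono) auto
    also have "\<dots> = real (Suc l) * exp 1 * exp (- real l) * real l ^ Suc l" by simp
    also have "\<dots> \<le> real (Suc l) * exp 1 * exp (- real l) * (exp (- 1) * real (Suc l) ^ Suc l)"
      by (intro mult_left_mono key) auto
    also have "\<dots> = exp 1 * real (Suc l) * (real (Suc l) ^ Suc l * exp (- real (Suc l)))"
      by (simp add: exp_diff exp_minus exp_add field_simps del: power_Suc)
    finally show ?case .
  qed (simp add: exp_minus)
  also have "\<dots> \<le> exp 1 * (real l + 1) * (real l ^ l * exp (- real l))"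
    by (intro mult_right_mono mult_left_mono) auto
  finally show ?thesis .
qed auto

text \<open>With l = n - k, Stirling's formula leaves exp k (l / n)^l. As (1 - k / n)^l \<le> exp (-
  k l / n), the exponents combine to k - k l / n = k^2 / n.\<close>

lemma fact_ratio_le:
  assumes n: "n > 0" and k: "k \<le> n"
  shows "fact (n - k) * exp (real n) / real n ^ (n - k) \<le> exp 1 * (real n + 1) * exp (real k ^ 2 / real n)"
proof -
  define l where "l = n - k"
  have nl: "real n = real l + real k" using k by (simp add: l_def)
  have "real l / real n = 1 + - (real k / real n)" using n nl by (simp add: field_simps)
  also have "\<dots> \<le> exp (- (real k / real n))" by (rule exp_ge_add_one_self)
  finally have "(real l / real n) ^ l \<le> exp (- (real k / real n)) ^ l" by (intro power_mono) auto
  also have "\<dots> = exp (- (real k / real n * real l))" by (simp add: mult.commute flip: exp_of_nat_mult)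
  finally have key: "(real l / real n) ^ l \<le> exp (- (real k / real n * real l))" .
  have "fact l * exp (real n) / real n ^ l
      \<le> exp 1 * (real l + 1) * (real l ^ l * exp (- real l)) * exp (real n) / real n ^ l"
    by (intro divide_right_mono mult_right_mono fact_le_exp) auto
  also have "\<dots> = exp 1 * (real l + 1) * (exp (real k) * (real l / real n) ^ l)"
    unfolding nl by (simp add: power_divide exp_add exp_minus)
  also have "\<dots> \<le> exp 1 * (real n + 1) * (exp (real k) * exp (- (real k / real n * real l)))"
    using nl by (intro mult_mono mult_left_mono key) auto
  also have "exp (real k) * exp (- (real k / real n * real l)) = exp (real k ^ 2 / real n)"
    using n nl by (simp add: flip: exp_add) (simp add: field_simps power2_eq_square)
  finally show ?thesis unfolding l_def .
qed

definition binomial_weight :: "nat \<Rightarrow> nat \<Rightarrow> real \<Rightarrow> real" where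
  "binomial_weight n k u = real (n choose k) * u ^ k * (1 - u) ^ (n - k)"

text \<open>
  The square of the binomial coefficient times the factorial is the number of matchings with
  \<open>n - k\<close> pairs; the last factor bounds the average of \<open>exp (- p X Y)\<close> over \<open>y\<close>.
\<close>

definition position_weight :: "nat \<Rightarrow> real \<Rightarrow> nat \<Rightarrow> real \<Rightarrow> real" where
  "position_weight n p k X = real (n choose k) ^ 2 * fact (n - k) * p ^ (n - k) *
     (exp (- (p * X) * real k) * exp_average (p * X) ^ (n - k))"

text \<open>Multiplying by \<open>tilt_sum * D\<close>, which is at least 1, makes the powers of X
  cancel: X^(n - k) stands in the denominator of the average over y and in the numerator of
  \<open>D\<close>. Each binomial weight receives one of the two binomial coefficients.\<close>

lemma position_weight_le:
  assumes n: "n > 0" and k: "k \<le> n" and p: "p > 0" and X: "1 \<le> X" "X \<le> real n"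
  shows "position_weight n p k X \<le> exp 1 * (real n + 1) *
      (exp (real k ^ 2 / real n) * binomial_weight n k (exp (- (p * X))) * binomial_weight n k (exp (- (real n / X))))
      * tilt_sum n k X"
proof -
  define u v l where "u = exp (- (p * X))" and "v = exp (- (real n / X))" and "l = n - k"
  have X0: "X > 0" using X by simp
  define D where "D = exp (real n / X * (X - real k)) * exp_average (real n / X) ^ l"
  have W: "position_weight n p k X = real (n choose k) ^ 2 * fact l * (u ^ k * (1 - u) ^ l / X ^ l)"
    unfolding position_weight_def exp_average_def u_def l_def using p X0
    by (simp add: power_divide power_mult_distrib mult.commute flip: exp_of_nat_mult)
  have D: "D = exp (real n) * v ^ k * ((1 - v) ^ l * X ^ l / real n ^ l)"
  proof -
    have "real n / X * (X - real k) = real n + real k * - (real n / X)" using X0 by (simp add: field_simps)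
    then have "exp (real n / X * (X - real k)) = exp (real n) * v ^ k"
      unfolding v_def by (simp only: exp_add exp_of_nat_mult)
    then show ?thesis unfolding D_def exp_average_def v_def using n X0 by (simp add: power_divide power_mult_distrib)
  qed
  have bw: "binomial_weight n k u \<ge> 0" "binomial_weight n k v \<ge> 0"
    unfolding binomial_weight_def u_def v_def using p X0 by (auto intro!: mult_nonneg_nonneg zero_le_power)
  have W0: "position_weight n p k X \<ge> 0"
    unfolding W u_def using p X0 by (auto intro!: mult_nonneg_nonneg divide_nonneg_nonneg zero_le_power)
  have "position_weight n p k X \<le> position_weight n p k X * (tilt_sum n k X * D)"
    using mult_left_mono[OF tilt_sum_ge[OF n X, of k] W0] unfolding D_def l_def by simp
  also have "\<dots> = (binomial_weight n k u * binomial_weight n k v) * (fact l * exp (real n) / real n ^ l) * tilt_sum n k X"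
    unfolding W D binomial_weight_def using X0 by (simp add: power2_eq_square l_def)
  also have "\<dots> \<le> (binomial_weight n k u * binomial_weight n k v) * (exp 1 * (real n + 1) * exp (real k ^ 2 / real n)) * tilt_sum n k X"
    unfolding l_def by (intro mult_right_mono mult_left_mono fact_ratio_le n k mult_nonneg_nonneg bw tilt_sum_nonneg)
  finally show ?thesis by (simp add: u_def v_def mult_ac)
qed

text \<open>For X < 1 the tilt n / X lies beyond the net, so the largest tilt n of the net replaces
  it. Only \<open>k = 0\<close> matters here, since every unmatched man adds 1 to X.\<close>

lemma position_weight_small:
  assumes n: "n > 0" and p: "p > 0" and X: "0 < X" "X < 1"
  shows "position_weight n p 0 X \<le> (p * exp 1) ^ n * tilt_sum n 0 X"
proof -
  have "position_weight n p 0 X = fact n * p ^ n * exp_average (p * X) ^ n"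
    by (simp add: position_weight_def)
  also have "\<dots> \<le> real n ^ n * p ^ n * 1"
  proof (intro mult_mono)
    show "fact n \<le> real n ^ n" using fact_le_power[where 'a = real, of n] by simp
    show "exp_average (p * X) ^ n \<le> 1"
      using p X exp_average_le_1[of "p * X"] exp_average_pos[of "p * X"] by (intro power_le_one) auto
  qed (use p X exp_average_pos[of "p * X"] in \<open>auto intro!: zero_le_power\<close>)
  also have "\<dots> = (p * exp 1) ^ n * (exp (- real n) * real n ^ n)"
    by (simp add: power_mult_distrib exp_minus flip: exp_of_nat_mult)
  also have "\<dots> \<le> (p * exp 1) ^ n * tilt_sum n 0 X"
  proof (rule mult_left_mono)
    have "exp (- real n) * real n ^ n \<le> exp (1 - real n * X) / exp_average (real n) ^ n"
    proof -
      have "real n * X \<le> real n * 1" using X by (intro mult_left_mono) auto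
      then have "exp (- real n) \<le> exp (1 - real n * X)" by simp
      moreover have "real n ^ n \<le> (1 / exp_average (real n)) ^ n"
        using exp_average_le[of "real n"] exp_average_pos[of "real n"] n by (intro power_mono) (auto simp: field_simps)
      ultimately have "exp (- real n) * real n ^ n \<le> exp (1 - real n * X) * (1 / exp_average (real n)) ^ n"
        by (intro mult_mono) auto
      then show ?thesis by (simp add: power_divide)
    qed
    also have "\<dots> = exp (1 - real (n\<^sup>2) / real n * (X - real 0)) / exp_average (real (n\<^sup>2) / real n) ^ (n - 0)"
      using n by (simp add: power2_eq_square)
    also have "\<dots> \<le> tilt_sum n 0 X"
      unfolding tilt_sum_def using n
      by (intro member_le_sum[of "n\<^sup>2"]) (auto simp: exp_average_def)
    finally show "exp (- real n) * real n ^ n \<le> tilt_sum n 0 X" .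
  qed (use p in auto)
  finally show ?thesis .
qed

section \<open>The product of the two binomial weights\<close>

lemma binomial_weight_nonneg: "0 \<le> u \<Longrightarrow> u \<le> 1 \<Longrightarrow> binomial_weight n k u \<ge> 0"
  by (simp add: binomial_weight_def)

text \<open>
  The product of two binomial probabilities is the square of a term of the binomial expansion of
  \<open>(\<surd>(u v) + \<surd>((1 - u) (1 - v)))\<^sup>n\<close>, the Bhattacharyya coefficient of the two distributions.
\<close>

lemma binomial_weight_product_le:
  assumes k: "k \<le> n" and u: "0 \<le> u" "u \<le> 1" and v: "0 \<le> v" "v \<le> 1"
  shows "exp (2 * \<theta> * real k) * binomial_weight n k u * binomial_weight n k v
    \<le> exp (2 * real n * (exp \<theta> * sqrt (u * v) - (u + v) / 2))"
proof -
  define a where "a = exp \<theta> * sqrt (u * v)"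
  define b where "b = sqrt ((1 - u) * (1 - v))"
  have ab: "a \<ge> 0" "b \<ge> 0" using u v by (auto simp: a_def b_def)
  have a2: "a\<^sup>2 = exp (2 * \<theta>) * (u * v)"
    unfolding a_def using u v by (simp add: power_mult_distrib flip: exp_double)
  have b2: "b\<^sup>2 = (1 - u) * (1 - v)" unfolding b_def using u v by simp
  have "exp (2 * \<theta> * real k) * binomial_weight n k u * binomial_weight n k v
      = (real (n choose k) * a ^ k * b ^ (n - k))\<^sup>2"
  proof -
    have "(real (n choose k) * a ^ k * b ^ (n - k))\<^sup>2 = (real (n choose k))\<^sup>2 * (a\<^sup>2) ^ k * (b\<^sup>2) ^ (n - k)"
      by (simp add: power_mult_distrib power_mult[symmetric] mult.commute)
    also have "\<dots> = (real (n choose k))\<^sup>2 * (exp (2 * \<theta>) ^ k * (u ^ k * v ^ k)) * ((1 - u) ^ (n - k) * (1 - v) ^ (n - k))"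
      unfolding a2 b2 by (simp add: power_mult_distrib)
    also have "exp (2 * \<theta>) ^ k = exp (2 * \<theta> * real k)" by (simp add: mult.commute flip: exp_of_nat_mult)
    finally have eq: "(real (n choose k) * a ^ k * b ^ (n - k))\<^sup>2 = (real (n choose k))\<^sup>2 *
        (exp (2 * \<theta> * real k) * (u ^ k * v ^ k)) * ((1 - u) ^ (n - k) * (1 - v) ^ (n - k))" .
    show ?thesis unfolding eq binomial_weight_def by (simp add: power2_eq_square mult_ac)
  qed
  also have "\<dots> \<le> ((a + b) ^ n)\<^sup>2"
  proof (rule power_mono)
    have "real (n choose k) * a ^ k * b ^ (n - k) \<le> (\<Sum>i\<le>n. real (n choose i) * a ^ i * b ^ (n - i))"
      using k ab by (intro member_le_sum[of k]) auto
    then show "real (n choose k) * a ^ k * b ^ (n - k) \<le> (a + b) ^ n" by (simp add: binomial_ring)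
  qed (use ab in auto)
  also have "\<dots> \<le> (exp (a - (u + v) / 2) ^ n)\<^sup>2"
  proof (intro power_mono)
    \<comment> \<open>Passing from the geometric to the arithmetic mean of \<open>1 - u\<close> and
      \<open>1 - v\<close> is the source of the gain \<open>- (u + v) / 2\<close>.\<close>
    have "b \<le> ((1 - u) + (1 - v)) / 2" unfolding b_def using u v by (intro arith_geo_mean_sqrt) auto
    then have "a + b \<le> 1 + (a - (u + v) / 2)" by (simp add: field_simps)
    also have "\<dots> \<le> exp (a - (u + v) / 2)" by (rule exp_ge_add_one_self)
    finally show "a + b \<le> exp (a - (u + v) / 2)" .
  qed (use ab in auto)
  also have "\<dots> = exp (2 * real n * (a - (u + v) / 2))"
    by (simp add: mult_ac flip: exp_of_nat_mult exp_double)
  finally show ?thesis by (simp add: a_def)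
qed

context
  fixes n k :: nat and p r X :: real
  assumes n: "n > 0" and k: "k \<le> n" and p: "p > 0" and r: "r = sqrt (p * real n)" and X: "0 < X"
begin

private definition u where "u = exp (- (p * X))"
private definition v where "v = exp (- (real n / X))"

private lemma uv: "0 \<le> u" "u \<le> 1" "0 \<le> v" "v \<le> 1"
  using p X by (auto simp: u_def v_def)

private lemma sqrt_uv_eq: "sqrt (u * v) = exp (- (p * X + real n / X) / 2)"
proof -
  have "u * v = (exp (- (p * X + real n / X) / 2))\<^sup>2"
    unfolding u_def v_def by (simp add: field_simps flip: exp_add exp_double)
  then show ?thesis by (metis abs_of_nonneg exp_ge_zero real_sqrt_abs)
qed

text \<open>The exponents \<open>p * X\<close> and \<open>n / X\<close> have product r^2, so their
  arithmetic mean is at least r.\<close>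

private lemma sqrt_uv_le: "sqrt (u * v) \<le> exp (- r)"
proof -
  have "sqrt ((p * X) * (real n / X)) \<le> (p * X + real n / X) / 2"
    using p X by (intro arith_geo_mean_sqrt) auto
  then have "r \<le> (p * X + real n / X) / 2" using X by (simp add: r)
  then show ?thesis unfolding sqrt_uv_eq by simp
qed

private lemma square_ratio_le: "exp (real k ^ 2 / real n) \<le> exp (real k)"
proof -
  have "real k * real k \<le> real k * real n" using k by (intro mult_left_mono) auto
  then show ?thesis using n by (simp add: power2_eq_square field_simps)
qed

text \<open>As k \<le> n, the factor exp (k^2 / n) is at most exp k, which \<theta> = 1 / 2 absorbs.
  Being valid for every X > 0, this bound may grow with n; it will be multiplied by the Chernoff
  factor exp (- \<tau> n).\<close>

lemma weight_product_le:
  "exp (real k ^ 2 / real n) * binomial_weight n k (exp (- (p * X))) * binomial_weight n k (exp (- (real n / X)))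
    \<le> exp (4 * real n * exp (- r))"
proof -
  have "exp (real k ^ 2 / real n) * binomial_weight n k u * binomial_weight n k v
      \<le> exp (2 * (1 / 2) * real k) * binomial_weight n k u * binomial_weight n k v"
    using square_ratio_le uv by (intro mult_right_mono binomial_weight_nonneg) auto
  also have "\<dots> \<le> exp (2 * real n * (exp (1 / 2) * sqrt (u * v) - (u + v) / 2))"
    by (rule binomial_weight_product_le[OF k uv])
  also have "\<dots> \<le> exp (4 * real n * exp (- r))"
  proof -
    have "exp (1 / 2) \<le> (2 :: real)" using exp_bound[of "1 / 2 :: real"] by (simp add: power2_eq_square)
    then have "exp (1 / 2) * sqrt (u * v) \<le> 2 * exp (- r)"
      using sqrt_uv_le uv by (intro mult_mono) auto
    then have "exp (1 / 2) * sqrt (u * v) - (u + v) / 2 \<le> 2 * exp (- r)" using uv(1,3) by argo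
    from mult_left_mono[OF this, of "2 * real n"] show ?thesis by simp
  qed
  finally show ?thesis by (simp add: u_def v_def)
qed

text \<open>Taking \<theta> = 1 pays for exp (k^2 / n) and leaves exp (- k), which excludes large
  k.\<close>

lemma weight_product_le_k:
  "exp (real k ^ 2 / real n) * binomial_weight n k (exp (- (p * X))) * binomial_weight n k (exp (- (real n / X)))
    \<le> exp (- real k + 6 * real n * exp (- r))"
proof -
  have "exp (real k ^ 2 / real n) * binomial_weight n k u * binomial_weight n k v
      \<le> (exp (- real k) * exp (2 * 1 * real k)) * binomial_weight n k u * binomial_weight n k v"
    using square_ratio_le uv by (intro mult_right_mono binomial_weight_nonneg) (auto simp flip: exp_add)
  also have "\<dots> = exp (- real k) * (exp (2 * 1 * real k) * binomial_weight n k u * binomial_weight n k v)" by simp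
  also have "\<dots> \<le> exp (- real k) * exp (2 * real n * (exp 1 * sqrt (u * v) - (u + v) / 2))"
    by (intro mult_left_mono binomial_weight_product_le[OF k uv]) auto
  also have "\<dots> \<le> exp (- real k) * exp (6 * real n * exp (- r))"
  proof -
    have "exp 1 * sqrt (u * v) \<le> 3 * exp (- r)"
      using sqrt_uv_le uv exp_le by (intro mult_mono) auto
    then have "exp 1 * sqrt (u * v) - (u + v) / 2 \<le> 3 * exp (- r)" using uv(1,3) by argo
    from mult_left_mono[OF this, of "2 * real n"] show ?thesis by simp
  qed
  finally show ?thesis by (simp add: u_def v_def flip: exp_add)
qed

text \<open>When X r / n differs from 1 by at least \<tau>, the geometric mean of u and v, even
  times exp (1 / 2), is at most a quarter of the larger of the two. Half of the larger one is
  subtracted, and it is at least exp (- r).\<close>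

lemma weight_product_le_bad:
  assumes \<tau>: "\<tau> > 0" "8 \<le> \<tau> * r" and bad: "\<tau> \<le> \<bar>X * r / real n - 1\<bar>"
  shows "exp (real k ^ 2 / real n) * binomial_weight n k (exp (- (p * X))) * binomial_weight n k (exp (- (real n / X)))
    \<le> exp (- (real n * exp (- r) / 2))"
proof -
  have r0: "r > 0" using n p by (simp add: r)
  define \<xi> where "\<xi> = X * r / real n"
  have \<xi>0: "\<xi> > 0" using X r0 n by (simp add: \<xi>_def)
  have pX: "p * X = \<xi> * r"
  proof -
    have "r * r = p * real n" using p by (simp add: r)
    then show ?thesis using n by (simp add: \<xi>_def field_simps)
  qed
  have nX: "real n / X = r / \<xi>" using n r0 X by (simp add: \<xi>_def)
  \<comment> \<open>The hypothesis \<open>8 \<le> \<tau> * r\<close> will supply \<open>d\<close>;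
    after paying for exp (1 / 2), a factor exp (- 7 / 2) is left.\<close>
  have quarter: "exp (1 / 2) * exp (- (d / 2)) \<le> (1 / 4 :: real)" if "8 \<le> d" for d :: real
  proof -
    have "exp (1 / 2) * exp (- (d / 2)) = exp (- (d / 2 - 1 / 2))" by (simp add: field_simps flip: exp_add)
    also have "\<dots> \<le> exp (- (7 / 2))" using that by simp
    also have "\<dots> \<le> 1 / 4"
      using exp_ge_add_one_self[of "7 / 2 :: real"] by (simp add: exp_minus field_simps)
    finally show ?thesis .
  qed
  have main: "exp (1 / 2) * sqrt (u * v) - (u + v) / 2 \<le> - (exp (- r) / 4)"
  proof (cases "\<xi> \<ge> 1")
    case True
    then have x: "\<xi> - 1 \<ge> \<tau>" using bad unfolding \<xi>_def[symmetric] by simp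
    have "1 / \<xi> \<le> 1" using True by simp
    then have "8 \<le> (\<xi> - 1 / \<xi>) * r"
      using x \<tau> r0 mult_right_mono[of \<tau> "\<xi> - 1 / \<xi>" r] by linarith
    then have "exp (1 / 2) * exp (- ((\<xi> - 1 / \<xi>) * r / 2)) \<le> 1 / 4" by (rule quarter)
    moreover have "sqrt (u * v) = exp (- ((\<xi> - 1 / \<xi>) * r / 2)) * v"
    proof -
      have "- (\<xi> * r + r / \<xi>) / 2 = - ((\<xi> - 1 / \<xi>) * r / 2) + - (r / \<xi>)"
        using \<xi>0 by (simp add: field_simps)
      then show ?thesis by (subst sqrt_uv_eq) (simp only: pX nX exp_add v_def)
    qed
    ultimately have "exp (1 / 2) * sqrt (u * v) \<le> 1 / 4 * v"
      using mult_right_mono[of "exp (1 / 2) * exp (- ((\<xi> - 1 / \<xi>) * r / 2))" "1 / 4" v] uv by simp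
    moreover have "exp (- r) \<le> v"
      unfolding v_def nX using True r0 by (simp add: field_simps)
    ultimately show ?thesis using uv(1) by (simp add: field_simps)
  next
    case False
    then have x: "1 - \<xi> \<ge> \<tau>" using bad unfolding \<xi>_def[symmetric] by simp
    have "1 / \<xi> \<ge> 1" using False \<xi>0 by simp
    then have "8 \<le> (1 / \<xi> - \<xi>) * r"
      using x \<tau> r0 mult_right_mono[of \<tau> "1 / \<xi> - \<xi>" r] by linarith
    then have "exp (1 / 2) * exp (- ((1 / \<xi> - \<xi>) * r / 2)) \<le> 1 / 4" by (rule quarter)
    moreover have "sqrt (u * v) = exp (- ((1 / \<xi> - \<xi>) * r / 2)) * u"
    proof -
      have "- (\<xi> * r + r / \<xi>) / 2 = - ((1 / \<xi> - \<xi>) * r / 2) + - (\<xi> * r)"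
        using \<xi>0 by (simp add: field_simps)
      then show ?thesis by (subst sqrt_uv_eq) (simp only: pX nX exp_add u_def)
    qed
    ultimately have "exp (1 / 2) * sqrt (u * v) \<le> 1 / 4 * u"
      using mult_right_mono[of "exp (1 / 2) * exp (- ((1 / \<xi> - \<xi>) * r / 2))" "1 / 4" u] uv by simp
    moreover have "exp (- r) \<le> u"
      unfolding u_def pX using False r0 by (simp add: field_simps)
    ultimately show ?thesis using uv(3) by (simp add: field_simps)
  qed
  have "exp (real k ^ 2 / real n) * binomial_weight n k u * binomial_weight n k v
      \<le> exp (2 * (1 / 2) * real k) * binomial_weight n k u * binomial_weight n k v"
    using square_ratio_le uv by (intro mult_right_mono binomial_weight_nonneg) auto
  also have "\<dots> \<le> exp (2 * real n * (exp (1 / 2) * sqrt (u * v) - (u + v) / 2))"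
    by (rule binomial_weight_product_le[OF k uv])
  also have "\<dots> \<le> exp (- (real n * exp (- r) / 2))"
    using mult_left_mono[OF main, of "2 * real n"] by simp
  finally show ?thesis by (simp add: u_def v_def)
qed

text \<open>Adding the bounds for 1 \<le> X and for X < 1 removes the case distinction from later
  arguments. In the second case \<open>real k \<le> X\<close> forces \<open>k = 0\<close>.\<close>

lemma position_weight_cases:
  assumes "X \<le> real n" "real k \<le> X" "0 \<le> b"
    and "exp (real k ^ 2 / real n) * binomial_weight n k (exp (- (p * X))) * binomial_weight n k (exp (- (real n / X))) \<le> b"
  shows "position_weight n p k X \<le> (exp 1 * (real n + 1) * b + (p * exp 1) ^ n) * tilt_sum n k X"
proof (cases "1 \<le> X")
  case True
  have "position_weight n p k X \<le> exp 1 * (real n + 1) *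
      (exp (real k ^ 2 / real n) * binomial_weight n k (exp (- (p * X))) * binomial_weight n k (exp (- (real n / X))))
      * tilt_sum n k X"
    by (rule position_weight_le[OF n k p True assms(1)])
  also have "\<dots> \<le> (exp 1 * (real n + 1) * b + 0) * tilt_sum n k X"
    using assms(4) by (simp add: mult_left_mono mult_right_mono tilt_sum_nonneg)
  also have "\<dots> \<le> (exp 1 * (real n + 1) * b + (p * exp 1) ^ n) * tilt_sum n k X"
    using p by (intro mult_right_mono add_left_mono) (auto simp: tilt_sum_nonneg)
  finally show ?thesis .
next
  case False
  then have k0: "k = 0" using assms(2) by linarith
  have "position_weight n p k X \<le> (0 + (p * exp 1) ^ n) * tilt_sum n k X"
    using position_weight_small[OF n p X] False unfolding k0 by simp
  also have "\<dots> \<le> (exp 1 * (real n + 1) * b + (p * exp 1) ^ n) * tilt_sum n k X"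
    using assms(3) by (intro mult_right_mono add_right_mono) (auto simp: tilt_sum_nonneg)
  finally show ?thesis .
qed

end

section \<open>From pointwise bounds to expected numbers of matchings\<close>

lemma positions_sum_range:
  assumes "N > 0" "n > 0" "I \<subseteq> {..<n}" "x \<in> set_pmf (random_positions n I N)"
  shows "0 < (\<Sum>i<n. x i)" "(\<Sum>i<n. x i) \<le> real n" "real (n - card I) \<le> (\<Sum>i<n. x i)"
proof -
  note x = random_positions_range[OF assms(1,4)]
  show "0 < (\<Sum>i<n. x i)" using x(1) assms(2) by (intro sum_pos) auto
  have "(\<Sum>i<n. x i) \<le> (\<Sum>i<n. 1)" by (intro sum_mono x(2))
  then show "(\<Sum>i<n. x i) \<le> real n" by simp
  have "real (n - card I) = real (card ({..<n} - I))"
    using assms(3) finite_subset[OF assms(3)] by (simp add: card_Diff_subset)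
  also have "\<dots> = (\<Sum>i\<in>{..<n} - I. x i)" using x(3) by simp
  also have "\<dots> \<le> (\<Sum>i<n. x i)" by (intro sum_mono2) (auto intro: less_imp_le x(1))
  finally show "real (n - card I) \<le> (\<Sum>i<n. x i)" .
qed

text \<open>The inner average over y is bounded by the last factor of
  \<open>position_weight\<close>, and the outer one over x by the mean of \<open>tilt_sum\<close>.
  The predicate \<open>S\<close> selects the range of X under consideration.\<close>

lemma expectation_weight_le:
  assumes N: "N > 0" and n: "n > 0" and p: "p > 0" and I: "I \<subseteq> {..<n}" and J: "J \<subseteq> {..<n}" "card J = card I"
    and H: "H \<ge> 0" "\<And>X. 0 < X \<Longrightarrow> X \<le> real n \<Longrightarrow> real (n - card I) \<le> X \<Longrightarrow> S X \<Longrightarrow>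
        position_weight n p (n - card I) X \<le> H * tilt_sum n (n - card I) X"
  shows "(real (n choose (n - card I)))\<^sup>2 * fact (card I) * (p ^ card I *
      measure_pmf.expectation (random_positions n I N) (\<lambda>x. measure_pmf.expectation (random_positions n J N) (\<lambda>y.
        of_bool (S (\<Sum>i<n. x i)) * exp (- p * (\<Sum>i<n. x i) * (\<Sum>j<n. y j)))))
    \<le> H * (exp 1 * real n ^ 2)"
proof -
  let ?k = "n - card I"
  let ?c = "(real (n choose ?k))\<^sup>2 * fact (card I) * p ^ card I"
  let ?PX = "random_positions n I N" and ?PY = "random_positions n J N"
  have cI: "card I \<le> n" using card_mono[OF _ I] by simp
  have int: "integrable (measure_pmf ?PX) f" for f :: "_ \<Rightarrow> real"
    using N by (intro integrable_measure_pmf_finite finite_set_random_positions)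
  have "(real (n choose ?k))\<^sup>2 * fact (card I) * (p ^ card I *
      measure_pmf.expectation ?PX (\<lambda>x. measure_pmf.expectation ?PY (\<lambda>y.
        of_bool (S (\<Sum>i<n. x i)) * exp (- p * (\<Sum>i<n. x i) * (\<Sum>j<n. y j)))))
    = measure_pmf.expectation ?PX (\<lambda>x. ?c * (of_bool (S (\<Sum>i<n. x i)) *
        measure_pmf.expectation ?PY (\<lambda>y. exp (- (p * (\<Sum>i<n. x i)) * (\<Sum>j<n. y j)))))"
    by (simp add: mult.assoc)
  also have "\<dots> \<le> measure_pmf.expectation ?PX (\<lambda>x. H * tilt_sum n ?k (\<Sum>i<n. x i))"
  proof (rule integral_mono_AE[OF int int], unfold AE_measure_pmf_iff, intro ballI)
    fix x assume "x \<in> set_pmf ?PX"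
    note X = positions_sum_range[OF N n I this]
    show "?c * (of_bool (S (\<Sum>i<n. x i)) *
        measure_pmf.expectation ?PY (\<lambda>y. exp (- (p * (\<Sum>i<n. x i)) * (\<Sum>j<n. y j))))
        \<le> H * tilt_sum n ?k (\<Sum>i<n. x i)"
    proof (cases "S (\<Sum>i<n. x i)")
      case True
      have "?c * measure_pmf.expectation ?PY (\<lambda>y. exp (- (p * (\<Sum>i<n. x i)) * (\<Sum>j<n. y j)))
          \<le> ?c * (exp (- (p * (\<Sum>i<n. x i)) * real ?k) * exp_average (p * (\<Sum>i<n. x i)) ^ card I)"
        using expectation_positions_exp[OF N _ J(1), of "p * (\<Sum>i<n. x i)"] p X J(2)
        by (intro mult_left_mono) auto
      also have "\<dots> = position_weight n p ?k (\<Sum>i<n. x i)"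
        unfolding position_weight_def using cI by (simp add: mult_ac)
      also have "\<dots> \<le> H * tilt_sum n ?k (\<Sum>i<n. x i)" using X True by (intro H)
      finally show ?thesis using True by simp
    qed (use H tilt_sum_nonneg in auto)
  qed
  also have "\<dots> = H * measure_pmf.expectation ?PX (\<lambda>x. tilt_sum n ?k (\<Sum>i<n. x i))" by simp
  also have "\<dots> \<le> H * (exp 1 * real n ^ 2)"
    by (intro mult_left_mono expectation_tilt_sum N I n H)
  finally show ?thesis .
qed

subsection \<open>Summing over all matchings\<close>

lemma expectation_swap_finite:
  fixes h :: "'a \<Rightarrow> 'b \<Rightarrow> real"
  assumes "finite (set_pmf P)" "finite (set_pmf Q)"
  shows "measure_pmf.expectation P (\<lambda>x. measure_pmf.expectation Q (h x))
    = measure_pmf.expectation Q (\<lambda>y. measure_pmf.expectation P (\<lambda>x. h x y))"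
proof -
  have "measure_pmf.expectation P (\<lambda>x. measure_pmf.expectation Q (h x))
      = measure_pmf.expectation (pair_pmf P Q) (\<lambda>(x, y). h x y)"
    using assms by (simp add: expectation_pair_pmf_finite)
  also have "\<dots> = measure_pmf.expectation (pair_pmf Q P) (\<lambda>(y, x). h x y)"
    by (subst pair_commute_pmf) (simp add: case_prod_unfold)
  also have "\<dots> = measure_pmf.expectation Q (\<lambda>y. measure_pmf.expectation P (\<lambda>x. h x y))"
    using assms by (simp add: expectation_pair_pmf_finite)
  finally show ?thesis .
qed

text \<open>The three groups stand for X or Y far from n / r, for many unmatched persons, and for a
  deviating rank in the remaining case. Here \<open>e\<close> comes from Stirling's formula,
  \<open>s\<close> from X < 1, and \<open>exp 1 * real n ^ 2\<close> bounds the mean of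
  \<open>tilt_sum\<close>.\<close>

definition tail_bound :: "nat \<Rightarrow> real \<Rightarrow> real \<Rightarrow> real" where
  "tail_bound n p \<tau> = (let r = sqrt (p * real n); s = (p * exp 1) ^ n; e = exp 1 * (real n + 1) in
     exp (p * real n) * (exp 1 * real n ^ 2) *
       (2 * (e * exp (- (real n * exp (- r) / 2)) + s)
        + (e * exp (6 * real n * exp (- r) - \<tau> * real n / r) + s)
        + 2 * exp (- \<tau> * real n) * (e * exp (4 * real n * exp (- r)) + s)))"

lemma tail_bound_nonneg: "p \<ge> 0 \<Longrightarrow> tail_bound n p \<tau> \<ge> 0"
  unfolding tail_bound_def Let_def by (auto intro!: mult_nonneg_nonneg add_nonneg_nonneg)

text \<open>The prefactor is the number of potential matchings of the size of \<open>M\<close>. With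
  it, the bound no longer depends on \<open>M\<close>, and a union bound only has to count the
  sizes.\<close>

lemma matching_prob_le:
  assumes r_def: "r = sqrt (p * real n)" and M: "is_matching n A0 M" and n: "n > 0" and p: "0 < p" "p \<le> 1"
    and \<tau>: "0 < \<tau>" "\<tau> \<le> 1 / 8" and r: "8 \<le> \<tau> * r" "r \<le> \<tau> * real n"
  shows "(real (n choose (n - card M)))\<^sup>2 * fact (card M) *
    measure_pmf.prob (random_instance n p) {(U, V, A).
       pattern_stable n M (above_partner n M U) (above_partner n (M\<inverse>) V \<circ> prod.swap) A \<and>
       \<not> ((1 - 8 * \<tau>) * (real n * r) \<le> real (card M + pattern_rank n M (above_partner n M U) A) \<and>
          real (card M + pattern_rank n M (above_partner n M U) A) \<le> (1 + 8 * \<tau>) * (real n * r))}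
    \<le> tail_bound n p \<tau>"
proof -
  let ?I = "fst ` M" and ?J = "snd ` M" and ?k = "n - card M"
  define c where "c = (real (n choose ?k))\<^sup>2 * fact (card M)"
  have M_sub: "M \<subseteq> {..<n} \<times> {..<n}" using M unfolding is_matching_def by auto
  then have I: "?I \<subseteq> {..<n}" and J: "?J \<subseteq> {..<n}" by auto
  have "x = y" if "x \<in> M" "y \<in> M" "fst x = fst y \<or> snd x = snd y" for x y
    using is_matching_unique[OF M that] .
  then have cI: "card ?I = card M" and cJ: "card ?J = card M"
    by (auto intro!: card_image inj_onI)
  have c0: "c > 0" unfolding c_def by simp
  have p_pos: "p > 0" by (rule p)
  have r0: "r > 0" using p n by (simp add: r_def)
  define E where "E = {(\<beta>, \<gamma>, A). pattern_stable n M \<beta> \<gamma> A \<and>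
       \<not> ((1 - 8 * \<tau>) * (real n * r) \<le> real (card M + pattern_rank n M \<beta> A) \<and>
          real (card M + pattern_rank n M \<beta> A) \<le> (1 + 8 * \<tau>) * (real n * r))}"
  define s where "s = (p * exp 1) ^ n"
  define e where "e = exp 1 * (real n + 1)"
  have es: "e \<ge> 0" "s \<ge> 0" using p by (auto simp: e_def s_def)
  define H1 where "H1 = e * exp (- (real n * exp (- r) / 2)) + s"
  define H2 where "H2 = e * exp (6 * real n * exp (- r) - \<tau> * real n / r) + s"
  define H3 where "H3 = e * exp (4 * real n * exp (- r)) + s"
  have H: "H1 \<ge> 0" "H2 \<ge> 0" "H3 \<ge> 0" using es by (auto simp: H1_def H2_def H3_def)
  define bad where "bad X \<longleftrightarrow> \<tau> \<le> \<bar>X * r / real n - 1\<bar>" for X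
  define badk where "badk \<longleftrightarrow> real ?k \<ge> \<tau> * real n / r"
  have "measure_pmf.prob (random_instance n p)
     {(U, V, A). (above_partner n M U, above_partner n (M\<inverse>) V \<circ> prod.swap, A) \<in> E}
     \<le> tail_bound n p \<tau> / c"
  proof (rule prob_instance_le[OF M])
    fix N :: nat assume N: "N > 0"
    let ?PX = "random_positions n ?I N" and ?PY = "random_positions n ?J N"
    define EE where "EE f = measure_pmf.expectation ?PX (\<lambda>x. measure_pmf.expectation ?PY (\<lambda>y. f x y))"
      for f :: "(nat \<Rightarrow> real) \<Rightarrow> (nat \<Rightarrow> real) \<Rightarrow> real"
    have fin: "finite (set_pmf ?PX)" "finite (set_pmf ?PY)"
      using N by (auto intro: finite_set_random_positions)
    have int: "integrable (measure_pmf ?PX) f" "integrable (measure_pmf ?PY) g" for f g :: "_ \<Rightarrow> real"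
      using fin by (auto intro: integrable_measure_pmf_finite)
    have EE_add: "EE (\<lambda>x y. f x y + g x y) = EE f + EE g" for f g
      unfolding EE_def by (simp add: Bochner_Integration.integral_add[OF int(1) int(1)]
        Bochner_Integration.integral_add[OF int(2) int(2)])
    have EE_mult: "EE (\<lambda>x y. a * f x y) = a * EE f" for a f
      unfolding EE_def by simp
    have EE_mono: "EE f \<le> EE g"
      if "\<And>x y. x \<in> set_pmf ?PX \<Longrightarrow> y \<in> set_pmf ?PY \<Longrightarrow> f x y \<le> g x y" for f g
      unfolding EE_def
      by (intro integral_mono_AE int) (auto simp: AE_measure_pmf_iff that intro!: integral_mono_AE int)
    let ?X = "\<lambda>x :: nat \<Rightarrow> real. \<Sum>i<n. x i"
    let ?e = "\<lambda>x y. exp (- p * ?X x * ?X y)"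
    have pt: "measure_pmf.prob (instance_law n p M x y) E
        \<le> p ^ card M * exp (p * real n) * (of_bool (bad (?X x)) * ?e x y + (of_bool (bad (?X y)) * ?e x y
          + (of_bool badk * ?e x y + 2 * exp (- \<tau> * real n) * ?e x y)))"
      if x: "x \<in> set_pmf ?PX" and y: "y \<in> set_pmf ?PY" for x y
    proof -
      interpret position_pattern n p M A0 x y
      proof
        show "is_matching n A0 M" by (rule M)
        show "0 \<le> p" "p \<le> 1" using p by auto
        show "0 < x i" "x i \<le> 1" "i \<notin> ?I \<Longrightarrow> x i = 1" for i
          using random_positions_range[OF N x, of i] by blast+
        show "0 < y i" "y i \<le> 1" "i \<notin> ?J \<Longrightarrow> y i = 1" for i
          using random_positions_range[OF N y, of i] by blast+
      qed
      let ?C = "p ^ card M * exp (p * real n)"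
      have C: "?C \<ge> 0" using p by simp
      show ?thesis
      \<comment> \<open>In the exceptional cases the rank condition is dropped, because stability
        alone will be rare there on average. Otherwise the hypotheses of the Chernoff bound
        hold.\<close>
      proof (cases "bad (?X x) \<or> bad (?X y) \<or> badk")
        case True
        have "measure_pmf.prob (instance_law n p M x y) E
            \<le> measure_pmf.prob (instance_law n p M x y) {(\<beta>, \<gamma>, A). pattern_stable n M \<beta> \<gamma> A}"
          unfolding E_def by (intro measure_pmf.finite_measure_mono) auto
        also have "\<dots> \<le> ?C * ?e x y" using prob_pattern_stable unfolding X_def Y_def .
        also have "\<dots> \<le> ?C * (of_bool (bad (?X x)) * ?e x y + (of_bool (bad (?X y)) * ?e x y
          + (of_bool badk * ?e x y + 2 * exp (- \<tau> * real n) * ?e x y)))"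
          using True C by (intro mult_left_mono) auto
        finally show ?thesis .
      next
        case False
        have "measure_pmf.prob (instance_law n p M x y) E
            \<le> ?C * ?e x y * (2 * exp (- \<tau> * real n))"
          unfolding E_def r_def X_def[symmetric] Y_def[symmetric]
          by (rule prob_pattern_tails_small)
             (use False n p_pos \<tau> r in \<open>auto simp: bad_def badk_def X_def Y_def r_def\<close>)
        also have "\<dots> = ?C * (2 * exp (- \<tau> * real n) * ?e x y)" by simp
        also have "\<dots> \<le> ?C * (of_bool (bad (?X x)) * ?e x y + (of_bool (bad (?X y)) * ?e x y
          + (of_bool badk * ?e x y + 2 * exp (- \<tau> * real n) * ?e x y)))"
          using C by (intro mult_left_mono) auto
        finally show ?thesis .
      qed
    qed
    have weight: "c * (p ^ card M * EE (\<lambda>x y. of_bool (S (?X x)) * ?e x y)) \<le> H * (exp 1 * real n ^ 2)"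
      if "H \<ge> 0" "\<And>X. 0 < X \<Longrightarrow> X \<le> real n \<Longrightarrow> real ?k \<le> X \<Longrightarrow> S X \<Longrightarrow>
        position_weight n p ?k X \<le> H * tilt_sum n ?k X" for S H
      using expectation_weight_le[OF N n p(1) I J, of H S] that unfolding c_def EE_def cI cJ by simp
    \<comment> \<open>\<open>position_weight\<close> depends only on the number of pairs, so after
      exchanging the two averages the same bound serves a condition on the women's
      positions.\<close>
    have weight': "c * (p ^ card M * EE (\<lambda>x y. of_bool (S (?X y)) * ?e x y)) \<le> H * (exp 1 * real n ^ 2)"
      if "H \<ge> 0" "\<And>X. 0 < X \<Longrightarrow> X \<le> real n \<Longrightarrow> real ?k \<le> X \<Longrightarrow> S X \<Longrightarrow>
        position_weight n p ?k X \<le> H * tilt_sum n ?k X" for S H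
    proof -
      have "EE (\<lambda>x y. of_bool (S (?X y)) * ?e x y)
          = measure_pmf.expectation ?PY (\<lambda>y. measure_pmf.expectation ?PX (\<lambda>x. of_bool (S (?X y)) * exp (- p * ?X y * ?X x)))"
        unfolding EE_def by (subst expectation_swap_finite[OF fin]) (simp add: mult_ac)
      then show ?thesis
        using expectation_weight_le[OF N n p(1) J I, of H S] that unfolding c_def cI cJ by simp
    qed
    have kn: "?k \<le> n" by simp
    have W1: "position_weight n p ?k X \<le> H1 * tilt_sum n ?k X"
      if "0 < X" "X \<le> real n" "real ?k \<le> X" "bad X" for X
      unfolding H1_def e_def s_def
      by (rule position_weight_cases[OF n kn p(1) r_def that(1-3)])
         (use weight_product_le_bad[OF n kn p(1) r_def that(1) \<tau>(1) r(1)] that(4) in \<open>auto simp: bad_def\<close>)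
    have W2: "position_weight n p ?k X \<le> H2 * tilt_sum n ?k X"
      if "0 < X" "X \<le> real n" "real ?k \<le> X" "badk" for X
      unfolding H2_def e_def s_def
    proof (rule position_weight_cases[OF n kn p(1) r_def that(1-3)])
      have "exp (- real ?k + 6 * real n * exp (- r)) \<le> exp (6 * real n * exp (- r) - \<tau> * real n / r)"
        using that(4) by (simp add: badk_def)
      then show "exp (real ?k ^ 2 / real n) * binomial_weight n ?k (exp (- (p * X))) * binomial_weight n ?k (exp (- (real n / X)))
          \<le> exp (6 * real n * exp (- r) - \<tau> * real n / r)"
        using weight_product_le_k[OF n kn p(1) r_def that(1)] by (rule order_trans[rotated])
    qed auto
    have W3: "position_weight n p ?k X \<le> H3 * tilt_sum n ?k X"
      if "0 < X" "X \<le> real n" "real ?k \<le> X" "True" for X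
      unfolding H3_def e_def s_def
      by (rule position_weight_cases[OF n kn p(1) r_def that(1-3)])
         (use weight_product_le[OF n kn p(1) r_def that(1)] in auto)
    let ?Z = "exp 1 * real n ^ 2"
    have "c * EE (\<lambda>x y. measure_pmf.prob (instance_law n p M x y) E)
        \<le> c * EE (\<lambda>x y. p ^ card M * exp (p * real n) * (of_bool (bad (?X x)) * ?e x y + (of_bool (bad (?X y)) * ?e x y
          + (of_bool badk * ?e x y + 2 * exp (- \<tau> * real n) * ?e x y))))"
      using c0 pt by (intro mult_left_mono EE_mono) auto
    also have "\<dots> = exp (p * real n) * (c * (p ^ card M * EE (\<lambda>x y. of_bool (bad (?X x)) * ?e x y))
        + (c * (p ^ card M * EE (\<lambda>x y. of_bool (bad (?X y)) * ?e x y))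
        + (c * (p ^ card M * EE (\<lambda>x y. of_bool badk * ?e x y))
        + 2 * exp (- \<tau> * real n) * (c * (p ^ card M * EE (\<lambda>x y. of_bool True * ?e x y))))))"
      by (simp only: EE_mult EE_add) (simp add: algebra_simps)
    also have "\<dots> \<le> exp (p * real n) * (H1 * ?Z + (H1 * ?Z + (H2 * ?Z + 2 * exp (- \<tau> * real n) * (H3 * ?Z))))"
    proof (intro mult_left_mono add_mono)
      show "c * (p ^ card M * EE (\<lambda>x y. of_bool (bad (?X x)) * ?e x y)) \<le> H1 * ?Z"
        using H W1 by (intro weight) auto
      show "c * (p ^ card M * EE (\<lambda>x y. of_bool (bad (?X y)) * ?e x y)) \<le> H1 * ?Z"
        using H W1 by (intro weight') auto
      show "c * (p ^ card M * EE (\<lambda>x y. of_bool badk * ?e x y)) \<le> H2 * ?Z"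
        using H W2 by (intro weight[where S = "\<lambda>_. badk"]) auto
      show "c * (p ^ card M * EE (\<lambda>x y. of_bool True * ?e x y)) \<le> H3 * ?Z"
        using H W3 by (intro weight[where S = "\<lambda>_. True"]) auto
    qed auto
    also have "\<dots> = tail_bound n p \<tau>"
      unfolding tail_bound_def Let_def r_def[symmetric] s_def[symmetric] e_def[symmetric]
        H1_def[symmetric] H2_def[symmetric] H3_def[symmetric]
      by (simp add: algebra_simps)
    finally have "c * EE (\<lambda>x y. measure_pmf.prob (instance_law n p M x y) E) \<le> tail_bound n p \<tau>" .
    then show "measure_pmf.expectation ?PX (\<lambda>x. measure_pmf.expectation ?PY (\<lambda>y.
          measure_pmf.prob (instance_law n p M x y) E)) \<le> tail_bound n p \<tau> / c"
      using c0 unfolding EE_def by (simp add: field_simps)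
  qed
  then have "c * measure_pmf.prob (random_instance n p)
     {(U, V, A). (above_partner n M U, above_partner n (M\<inverse>) V \<circ> prod.swap, A) \<in> E} \<le> tail_bound n p \<tau>"
    using c0 by (simp add: field_simps)
  then show ?thesis unfolding E_def c_def by simp
qed

text \<open>A matching is determined by its set of men together with the list of their wives in
  increasing order of the men.\<close>

lemma card_matchings_le:
  "card {M. is_matching n (\<lambda>_. True) M \<and> card M = l} \<le> (n choose l)\<^sup>2 * fact l"
proof -
  let ?S = "{M. is_matching n (\<lambda>_. True) M \<and> card M = l}"
  let ?T = "{I. I \<subseteq> {..<n} \<and> card I = l} \<times> {ws. length ws = l \<and> distinct ws \<and> set ws \<subseteq> {..<n}}"
  define dec where "dec = (\<lambda>(I :: nat set, ws :: nat list). set (zip (sorted_list_of_set I) ws))"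
  have finT: "finite ?T"
    using finite_lists_length_eq[of "{..<n}" l]
    by (intro finite_cartesian_product) (auto elim!: finite_subset[rotated])
  have "?S \<subseteq> dec ` ?T"
  proof
    fix M assume "M \<in> ?S"
    then have M: "is_matching n (\<lambda>_. True) M" "card M = l" by auto
    have sub: "M \<subseteq> {..<n} \<times> {..<n}" using M unfolding is_matching_def by auto
    then have fin: "finite M" by (rule finite_subset) simp
    have uniq: "x = y" if "x \<in> M" "y \<in> M" "fst x = fst y \<or> snd x = snd y" for x y
      using is_matching_unique[OF M(1) that] .
    define I where "I = fst ` M"
    define f where "f i = (THE w. (i, w) \<in> M)" for i
    have f: "f i = w" if "(i, w) \<in> M" for i w
      unfolding f_def by (rule the_equality) (use that uniq in force)+
    have finI: "finite I" using fin by (simp add: I_def)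
    have cI: "card I = l" unfolding I_def using M(2) uniq by (subst card_image) (auto intro!: inj_onI)
    let ?ws = "map f (sorted_list_of_set I)"
    have fI: "(i, f i) \<in> M" if "i \<in> I" for i using that f unfolding I_def by force
    have "inj_on f I"
    proof (rule inj_onI)
      fix i i' assume i: "i \<in> I" "i' \<in> I" "f i = f i'"
      have "(i, f i) = (i', f i')" by (rule uniq[OF fI[OF i(1)] fI[OF i(2)]]) (simp add: i(3))
      then show "i = i'" by simp
    qed
    then have "distinct ?ws" using finI by (simp add: distinct_map)
    moreover have "set ?ws \<subseteq> {..<n}" using fI sub finI by auto
    ultimately have mem: "(I, ?ws) \<in> ?T" using cI sub by (auto simp: I_def)
    have dec: "dec (I, ?ws) = M"
    proof -
      have "zip (sorted_list_of_set I) ?ws = map (\<lambda>i. (i, f i)) (sorted_list_of_set I)"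
        by (simp add: zip_map2 zip_same_conv_map)
      then have "dec (I, ?ws) = (\<lambda>i. (i, f i)) ` I" using finI by (simp add: dec_def)
      also have "\<dots> = M" using fI f by (force simp: I_def)
      finally show ?thesis .
    qed
    have "dec (I, ?ws) \<in> dec ` ?T" using mem by (rule imageI)
    then show "M \<in> dec ` ?T" unfolding dec .
  qed
  then have "card ?S \<le> card (dec ` ?T)" using finT by (intro card_mono finite_imageI)
  also have "\<dots> \<le> card ?T" using finT by (rule card_image_le)
  also have "card ?T = (n choose l) * card {ws. length ws = l \<and> distinct ws \<and> set ws \<subseteq> {..<n}}"
    by (simp add: card_cartesian_product n_subsets)
  also have "card {ws. length ws = l \<and> distinct ws \<and> set ws \<subseteq> {..<n}} = (n choose l) * fact l"
  proof (cases "l \<le> n")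
    case True
    have "card {ws. length ws = l \<and> distinct ws \<and> set ws \<subseteq> {..<n}} = \<Prod>{n - l + 1..n}"
      using card_lists_distinct_length_eq[of "{..<n}" l] True by simp
    also have "\<dots> = fact n div fact (n - l)" using True by (simp add: fact_div_fact)
    also have "fact n = ((n choose l) * fact l) * fact (n - l)"
      using binomial_fact_lemma[OF True] by (simp add: mult_ac)
    finally show ?thesis by simp
  next
    case False
    have "length ws \<le> n" if "distinct ws" "set ws \<subseteq> {..<n}" for ws :: "nat list"
      using card_mono[OF _ that(2)] distinct_card[OF that(1)] by simp
    then have "{ws. length ws = l \<and> distinct ws \<and> set ws \<subseteq> {..<n}} = {}" using False by auto
    then show ?thesis using False by (simp only: card.empty) (simp add: binomial_eq_0)
  qed
  finally show ?thesis by (simp add: power2_eq_square)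
qed

section \<open>From comparison patterns back to stable matchings\<close>

lemma set_random_preferences:
  "U \<in> set_pmf (random_preferences n) \<Longrightarrow> m < n \<Longrightarrow> U m \<in> permutations_of_set {..<n}"
  unfolding random_preferences_def by (auto simp: set_Pi_pmf PiE_dflt_def)

lemma stable_matching_pattern:
  assumes M: "M \<in> stable_matchings n U V A"
  shows "is_matching n (\<lambda>_. True) M"
    and "pattern_stable n M (above_partner n M U) (above_partner n (M\<inverse>) V \<circ> prod.swap) A"
proof -
  have match: "is_matching n A M" and nb: "\<not> is_blocking n U V A M e" for e
    using M unfolding stable_matchings_def by blast+
  show True_match: "is_matching n (\<lambda>_. True) M"
    using match unfolding is_matching_def by auto
  have adm: "A e" if "e \<in> M" for e
    using match that unfolding is_matching_def by auto
  have "is_blocking n U V A M (i, j)"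
    if "i < n" "j < n" "(i, j) \<notin> M" "A (i, j)" "above_partner n M U (i, j)"
      "(above_partner n (M\<inverse>) V \<circ> prod.swap) (i, j)" for i j
    using that unfolding is_blocking_def above_partner_def by auto
  then show "pattern_stable n M (above_partner n M U) (above_partner n (M\<inverse>) V \<circ> prod.swap) A"
    using adm nb unfolding pattern_stable_def by auto
qed

text \<open>Mapping a matched pair (m, w) and a better woman w' to (m, w') is injective because m
  has only one wife; the image is the set counted by \<open>pattern_rank\<close>.\<close>

lemma total_wife_rank_pattern:
  assumes M: "is_matching n A0 M" and U: "\<And>m. m < n \<Longrightarrow> U m \<in> permutations_of_set {..<n}"
  shows "total_wife_rank n U A M = card M + pattern_rank n M (above_partner n M U) A"
proof -
  have sub: "M \<subseteq> {..<n} \<times> {..<n}" using M unfolding is_matching_def by auto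
  then have fin: "finite M" by (rule finite_subset) simp
  have row: "w' = w" if "(m, w) \<in> M" "(m, w') \<in> M" for m w w'
    using is_matching_unique[OF M that] by simp
  let ?S = "\<lambda>e. {w'. w' < n \<and> A (fst e, w') \<and> prefers (U (fst e)) w' (snd e)}"
  have "total_wife_rank n U A M = card M + (\<Sum>e\<in>M. card (?S e))"
    unfolding total_wife_rank_def wife_rank_def case_prod_unfold sum.distrib by simp
  also have "(\<Sum>e\<in>M. card (?S e)) = card (SIGMA e:M. ?S e)"
    using fin by (intro card_SigmaI[symmetric]) auto
  also have "\<dots> = card ((\<lambda>(e, w'). (fst e, w')) ` (SIGMA e:M. ?S e))"
    by (rule card_image[symmetric]) (auto intro!: inj_onI dest: row)
  also have "(\<lambda>(e, w'). (fst e, w')) ` (SIGMA e:M. ?S e)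
      = {e \<in> matched_rows n M. A e \<and> above_partner n M U e}" (is "?L = ?R")
  proof (intro equalityI subsetI)
    fix e assume "e \<in> ?L"
    then obtain m w w' where e: "e = (m, w')" "(m, w) \<in> M" "w' < n" "A (m, w')" "prefers (U m) w' w"
      by auto
    have m: "m < n" using e sub by auto
    have "w' \<noteq> w"
      using e(5) prefers_irrefl[of "U m" w] U[OF m] by (auto simp: permutations_of_set_def)
    then have "(m, w') \<notin> M" using row[OF e(2)] by auto
    moreover have "m \<in> fst ` M" using e(2) by force
    moreover have "above_partner n M U (m, w')"
      unfolding above_partner_def case_prod_conv
    proof (intro conjI allI impI)
      show "prefers (U m) w' x" if "(m, x) \<in> M" for x
        using row[OF e(2) that] e(5) by simp
    qed (use m e(3) in auto)
    ultimately show "e \<in> ?R" using m e by (auto simp: matched_rows_def)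
  next
    fix e assume "e \<in> ?R"
    then obtain m w w' where e: "e = (m, w')" "m < n" "w' < n" "(m, w) \<in> M" "A (m, w')" "above_partner n M U (m, w')"
      by (auto simp: matched_rows_def)
    then have "((m, w), w') \<in> (SIGMA e:M. ?S e)" by (auto simp: above_partner_def)
    then show "e \<in> ?L" using e(1) by force
  qed
  finally show ?thesis by (simp add: pattern_rank_def)
qed

text \<open>A union bound over all potential matchings: those of one size contribute at most
  \<open>tail_bound\<close> together, and there are n + 1 sizes.\<close>

lemma prob_rank_deviation_le:
  assumes r: "r = sqrt (p * real n)" and n: "n > 0" and p: "0 < p" "p \<le> 1"
    and \<tau>: "0 < \<tau>" "\<tau> \<le> 1 / 8" and r\<tau>: "8 \<le> \<tau> * r" "r \<le> \<tau> * real n"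
  shows "measure_pmf.prob (random_instance n p) {(U, V, A). \<exists>M\<in>stable_matchings n U V A.
      \<not> ((1 - 8 * \<tau>) * (real n * r) \<le> real (total_wife_rank n U A M) \<and>
         real (total_wife_rank n U A M) \<le> (1 + 8 * \<tau>) * (real n * r))}
    \<le> (real n + 1) * tail_bound n p \<tau>" (is "?lhs \<le> _")
proof -
  let ?P = "random_instance n p"
  define Ms where "Ms = {M. is_matching n (\<lambda>_. True) M}"
  have "Ms \<subseteq> Pow ({..<n} \<times> {..<n})" unfolding Ms_def is_matching_def by auto
  then have finMs: "finite Ms" by (rule finite_subset) simp
  define Ev where "Ev M = {(U, V, A).
       pattern_stable n M (above_partner n M U) (above_partner n (M\<inverse>) V \<circ> prod.swap) A \<and>
       \<not> ((1 - 8 * \<tau>) * (real n * r) \<le> real (card M + pattern_rank n M (above_partner n M U) A) \<and>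
          real (card M + pattern_rank n M (above_partner n M U) A) \<le> (1 + 8 * \<tau>) * (real n * r))}" for M
  define h where "h l = tail_bound n p \<tau> / ((real (n choose l))\<^sup>2 * fact l)" for l
  have Ev_le: "measure_pmf.prob ?P (Ev M) \<le> h (card M)" and cM: "card M \<le> n" if "M \<in> Ms" for M
  proof -
    have M: "is_matching n (\<lambda>_. True) M" using that by (simp add: Ms_def)
    \<comment> \<open>Constant positions 1 satisfy the locale; what is taken from it is the bound
      \<open>card_M_le\<close>.\<close>
    interpret position_pattern n p M "\<lambda>_. True" "\<lambda>_. 1" "\<lambda>_. 1"
      by unfold_locales (use M p in simp_all)
    show c: "card M \<le> n" by (rule card_M_le)
    have "n choose (n - card M) = n choose card M" using binomial_symmetric[OF c] by simp
    then have "(real (n choose card M))\<^sup>2 * fact (card M) * measure_pmf.prob ?P (Ev M) \<le> tail_bound n p \<tau>"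
      using matching_prob_le[OF r M n _ _ \<tau> r\<tau>] \<open>0 < p\<close> \<open>p \<le> 1\<close> unfolding Ev_def by simp
    moreover have "(real (n choose card M))\<^sup>2 * fact (card M) > 0" using c by simp
    ultimately show "measure_pmf.prob ?P (Ev M) \<le> h (card M)"
      unfolding h_def by (simp add: field_simps)
  qed
  have "?lhs \<le> measure_pmf.prob ?P (\<Union>M\<in>Ms. Ev M)"
  proof (rule measure_pmf.finite_measure_mono_AE)
    show "AE \<omega> in measure_pmf ?P. \<omega> \<in> {(U, V, A). \<exists>M\<in>stable_matchings n U V A.
      \<not> ((1 - 8 * \<tau>) * (real n * r) \<le> real (total_wife_rank n U A M) \<and>
         real (total_wife_rank n U A M) \<le> (1 + 8 * \<tau>) * (real n * r))} \<longrightarrow> \<omega> \<in> (\<Union>M\<in>Ms. Ev M)"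
      unfolding AE_measure_pmf_iff
    proof (intro ballI impI)
      fix \<omega> assume \<omega>: "\<omega> \<in> set_pmf ?P" and dev: "\<omega> \<in> {(U, V, A). \<exists>M\<in>stable_matchings n U V A.
      \<not> ((1 - 8 * \<tau>) * (real n * r) \<le> real (total_wife_rank n U A M) \<and>
         real (total_wife_rank n U A M) \<le> (1 + 8 * \<tau>) * (real n * r))}"
      obtain U V A where UVA: "\<omega> = (U, V, A)" by (cases \<omega>)
      have U: "U m \<in> permutations_of_set {..<n}" if "m < n" for m
        using \<omega> that set_random_preferences by (auto simp: UVA random_instance_def)
      from dev obtain M where M: "M \<in> stable_matchings n U V A" and
        rank: "\<not> ((1 - 8 * \<tau>) * (real n * r) \<le> real (total_wife_rank n U A M) \<and>
         real (total_wife_rank n U A M) \<le> (1 + 8 * \<tau>) * (real n * r))"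
        unfolding UVA by blast
      note pat = stable_matching_pattern[OF M]
      have "total_wife_rank n U A M = card M + pattern_rank n M (above_partner n M U) A"
        using pat(1) U by (rule total_wife_rank_pattern)
      then have "\<omega> \<in> Ev M"
        using pat(2) rank unfolding UVA Ev_def by simp
      then show "\<omega> \<in> (\<Union>M\<in>Ms. Ev M)" using pat(1) unfolding Ms_def by blast
    qed
  qed simp
  also have "\<dots> \<le> (\<Sum>M\<in>Ms. measure_pmf.prob ?P (Ev M))"
    using finMs by (intro measure_pmf.finite_measure_subadditive_finite) auto
  also have "\<dots> \<le> (\<Sum>M\<in>Ms. h (card M))" by (intro sum_mono Ev_le)
  also have "\<dots> = (\<Sum>l\<in>{..n}. \<Sum>M\<in>{M\<in>Ms. card M = l}. h (card M))"
    using cM by (intro sum.group[symmetric] finMs) auto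
  also have "\<dots> \<le> (\<Sum>l\<in>{..n}. tail_bound n p \<tau>)"
  proof (rule sum_mono)
    fix l assume "l \<in> {..n}"
    then have pos: "(real (n choose l))\<^sup>2 * fact l > 0" by simp
    then have ne: "(real (n choose l))\<^sup>2 * fact l \<noteq> 0" by (rule less_imp_neq[symmetric])
    have h0: "h l \<ge> 0" using tail_bound_nonneg p pos unfolding h_def by simp
    have "(\<Sum>M\<in>{M\<in>Ms. card M = l}. h (card M)) = real (card {M\<in>Ms. card M = l}) * h l" by simp
    also have "\<dots> \<le> real ((n choose l)\<^sup>2 * fact l) * h l"
      using card_matchings_le[of n l] h0 unfolding Ms_def mem_Collect_eq
      by (intro mult_right_mono) (simp_all only: of_nat_le_iff)
    also have "\<dots> = tail_bound n p \<tau>" unfolding h_def of_nat_mult of_nat_power of_nat_fact times_divide_eq_right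
      by (rule nonzero_mult_div_cancel_left[OF ne])
    finally show "(\<Sum>M\<in>{M\<in>Ms. card M = l}. h (card M)) \<le> tail_bound n p \<tau>" .
  qed
  also have "\<dots> = (real n + 1) * tail_bound n p \<tau>" by simp
  finally show ?thesis .
qed

text \<open>Here r = g ln n, so n exp (- r) = n^(1 - g). In \<open>?t1\<close> this power beats the
  prefactor exp (g^2 ln^2 n). In \<open>?t2\<close> and \<open>?t3\<close> it is itself beaten by
  \<tau> n / r and by \<tau> n. The term \<open>?t4\<close> decays like exp (- n ln n) to leading
  order in the exponent.\<close>

lemma tail_bound_tendsto_0:
  fixes g \<tau> :: real
  assumes g: "0 < g" "g < 1" and \<tau>: "0 < \<tau>"
  shows "(\<lambda>n. (real n + 1) * tail_bound n (g\<^sup>2 * (ln (real n))\<^sup>2 / real n) \<tau>) \<longlonglongrightarrow> 0"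
proof -
  let ?f = "\<lambda>n. (real n + 1) * (exp (g\<^sup>2 * (ln (real n))\<^sup>2) * (exp 1 * real n ^ 2))"
  let ?e = "\<lambda>n. exp 1 * (real n + 1)"
  let ?s = "\<lambda>n. exp (real n * ln (g\<^sup>2 * (ln (real n))\<^sup>2 / real n * exp 1))"
  let ?t1 = "\<lambda>n. ?f n * (?e n * exp (- (real n * exp (- (g * ln (real n))) / 2)))"
  let ?t2 = "\<lambda>n. ?f n * (?e n * exp (6 * real n * exp (- (g * ln (real n))) - \<tau> * real n / (g * ln (real n))))"
  let ?t3 = "\<lambda>n. ?f n * (2 * exp (- \<tau> * real n) * (?e n * exp (4 * real n * exp (- (g * ln (real n))))))"
  let ?t4 = "\<lambda>n. ?f n * ?s n"
  have t1: "?t1 \<longlonglongrightarrow> 0" using g by real_asymp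
  have t2: "?t2 \<longlonglongrightarrow> 0" using g \<tau> by real_asymp
  have t3: "?t3 \<longlonglongrightarrow> 0" using g \<tau> by real_asymp
  have t4: "?t4 \<longlonglongrightarrow> 0" using g by real_asymp
  have ex: "(\<lambda>n. exp (- \<tau> * real n)) \<longlonglongrightarrow> 0" using \<tau> by real_asymp
  have "(\<lambda>n. 2 * (?t1 n + ?t4 n) + (?t2 n + ?t4 n) + (?t3 n + 2 * (exp (- \<tau> * real n) * ?t4 n)))
     \<longlonglongrightarrow> 2 * (0 + 0) + (0 + 0) + (0 + 2 * (0 * 0))"
    by (intro tendsto_intros t1 t2 t3 t4 ex)
  then have lim: "(\<lambda>n. 2 * (?t1 n + ?t4 n) + (?t2 n + ?t4 n) + (?t3 n + 2 * (exp (- \<tau> * real n) * ?t4 n))) \<longlonglongrightarrow> 0"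
    by simp
  have "\<forall>\<^sub>F n in sequentially. 2 * (?t1 n + ?t4 n) + (?t2 n + ?t4 n) + (?t3 n + 2 * (exp (- \<tau> * real n) * ?t4 n))
      = (real n + 1) * tail_bound n (g\<^sup>2 * (ln (real n))\<^sup>2 / real n) \<tau>"
    using eventually_gt_at_top[of 1]
  proof eventually_elim
    case (elim n)
    define p where "p = g\<^sup>2 * (ln (real n))\<^sup>2 / real n"
    have l0: "ln (real n) > 0" using elim by simp
    have p0: "p > 0" unfolding p_def using g l0 elim by simp
    have pn: "p * real n = g\<^sup>2 * (ln (real n))\<^sup>2" unfolding p_def using elim by simp
    have r: "sqrt (p * real n) = g * ln (real n)"
      unfolding pn using g l0 by (simp add: real_sqrt_mult)
    have s: "(p * exp 1) ^ n = exp (real n * ln (p * exp 1))"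
      using p0 by (simp add: exp_of_nat_mult)
    have rearrange: "2 * (N * F * (e * E1) + N * F * s) + (N * F * (e * E2) + N * F * s)
        + (N * F * (2 * d * (e * E3)) + 2 * (d * (N * F * s)))
      = N * (F * (2 * (e * E1 + s) + (e * E2 + s) + 2 * d * (e * E3 + s)))" for N F e E1 E2 E3 d s :: real
      by (simp add: algebra_simps)
    show ?case
      unfolding tail_bound_def Let_def p_def[symmetric] r s unfolding pn by (rule rearrange)
  qed
  with lim show ?thesis by (rule Lim_transform_eventually)
qed

section \<open>The events of the theorem and their limits\<close>

definition wife_ranks_within ::
    "nat \<Rightarrow> real \<Rightarrow> real \<Rightarrow> (preferences \<times> preferences \<times> (nat \<times> nat \<Rightarrow> bool)) set" where
  "wife_ranks_within n a b = {(U, V, A). \<lfloor>a\<rfloor> \<le> int (Q_min n U V A)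
     \<and> Q_min n U V A \<le> Q_max n U V A \<and> int (Q_max n U V A) \<le> \<lfloor>b\<rfloor>}"

text \<open>The set of ranks is finite and almost surely nonempty, so the minimum and the maximum
  are ranks of actual stable matchings. Taking floors preserves the inequalities because ranks are
  integers.\<close>

lemma prob_wife_ranks_within_ge:
  "1 - measure_pmf.prob (random_instance n p) {(U, V, A). \<exists>M\<in>stable_matchings n U V A.
      \<not> (a \<le> real (total_wife_rank n U A M) \<and> real (total_wife_rank n U A M) \<le> b)}
    \<le> measure_pmf.prob (random_instance n p) (wife_ranks_within n a b)" (is "1 - measure_pmf.prob ?P ?B \<le> _")
proof -
  have "1 - measure_pmf.prob ?P ?B = measure_pmf.prob ?P (- ?B)"
    using measure_pmf.prob_compl[of ?B ?P] by (simp add: Compl_eq_Diff_UNIV)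
  also have "\<dots> \<le> measure_pmf.prob ?P (wife_ranks_within n a b)"
  proof (rule measure_pmf.finite_measure_mono_AE)
    show "AE \<omega> in measure_pmf ?P. \<omega> \<in> - ?B \<longrightarrow> \<omega> \<in> wife_ranks_within n a b"
      unfolding AE_measure_pmf_iff
    proof (intro ballI impI)
      fix \<omega> assume \<omega>: "\<omega> \<in> set_pmf ?P" and good: "\<omega> \<in> - ?B"
      obtain U V A where UVA: "\<omega> = (U, V, A)" by (cases \<omega>)
      have lists: "U m \<in> permutations_of_set {..<n}" "V m \<in> permutations_of_set {..<n}" if "m < n" for m
        using \<omega> that set_random_preferences by (auto simp: UVA random_instance_def)
      let ?R = "total_wife_rank n U A ` stable_matchings n U V A"
      have fin: "finite ?R" by (intro finite_imageI finite_stable_matchings)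
      have ne: "?R \<noteq> {}" using stable_matchings_nonempty[of n U V A] lists by simp
      have range: "a \<le> real q \<and> real q \<le> b" if "q \<in> ?R" for q
        using good that unfolding UVA by auto
      have "a \<le> real (Q_min n U V A)"
        using range[OF Min_in[OF fin ne]] unfolding Q_min_def by simp
      then have "\<lfloor>a\<rfloor> \<le> int (Q_min n U V A)" by linarith
      moreover have "real (Q_max n U V A) \<le> b"
        using range[OF Max_in[OF fin ne]] unfolding Q_max_def by simp
      then have "int (Q_max n U V A) \<le> \<lfloor>b\<rfloor>" by linarith
      moreover have "Q_min n U V A \<le> Q_max n U V A"
        unfolding Q_min_def Q_max_def using fin ne by (meson Max_ge Min_in)
      ultimately show "\<omega> \<in> wife_ranks_within n a b"
        unfolding UVA wife_ranks_within_def by simp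
    qed
  qed simp
  finally show ?thesis .
qed

lemma prob_husband_ranks_within:
  "measure_pmf.prob (random_instance n p) {(U, V, A). \<lfloor>a\<rfloor> \<le> int (R_min n U V A)
     \<and> R_min n U V A \<le> R_max n U V A \<and> int (R_max n U V A) \<le> \<lfloor>b\<rfloor>}
   = measure_pmf.prob (random_instance n p) (wife_ranks_within n a b)"
proof -
  have "measure_pmf.prob (random_instance n p) (wife_ranks_within n a b)
      = measure_pmf.prob (map_pmf (\<lambda>(U, V, A). (V, U, A \<circ> prod.swap)) (random_instance n p)) (wife_ranks_within n a b)"
    unfolding random_instance_swap ..
  also have "\<dots> = measure_pmf.prob (random_instance n p)
      ((\<lambda>(U, V, A). (V, U, A \<circ> prod.swap)) -` wife_ranks_within n a b)"
    by (rule measure_map_pmf)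
  also have "(\<lambda>(U, V, A). (V, U, A \<circ> prod.swap)) -` wife_ranks_within n a b
      = {(U, V, A). \<lfloor>a\<rfloor> \<le> int (R_min n U V A)
     \<and> R_min n U V A \<le> R_max n U V A \<and> int (R_max n U V A) \<le> \<lfloor>b\<rfloor>}"
    by (auto simp: wife_ranks_within_def R_min_eq R_max_eq)
  finally show ?thesis ..
qed

theorem theorem1p6:
  fixes c \<epsilon> :: real and p :: "nat \<Rightarrow> real"
  assumes c: "0 < c" "c < 1"
    and p: "\<And>n. n \<ge> 1 \<Longrightarrow> p n = c * (ln (real n))\<^sup>2 / real n"
    and eps: "0 < \<epsilon>" "\<epsilon> < 1"
  shows "(\<lambda>n. measure_pmf.prob (random_instance n (p n))
            {(U, V, A). \<lfloor>(1 - \<epsilon>) * sqrt (p n * real n ^ 3)\<rfloor> \<le> int (Q_min n U V A)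
               \<and> Q_min n U V A \<le> Q_max n U V A
               \<and> int (Q_max n U V A) \<le> \<lfloor>(1 + \<epsilon>) * sqrt (p n * real n ^ 3)\<rfloor>}) \<longlonglongrightarrow> 1
       \<and> (\<lambda>n. measure_pmf.prob (random_instance n (p n))
            {(U, V, A). \<lfloor>(1 - \<epsilon>) * sqrt (p n * real n ^ 3)\<rfloor> \<le> int (R_min n U V A)
               \<and> R_min n U V A \<le> R_max n U V A
               \<and> int (R_max n U V A) \<le> \<lfloor>(1 + \<epsilon>) * sqrt (p n * real n ^ 3)\<rfloor>}) \<longlonglongrightarrow> 1"
proof -
  \<comment> \<open>This makes r equal to \<open>g * ln (real n)\<close>; the 8 in
    \<open>\<tau>\<close> matches the relative error \<open>8 * \<tau>\<close> of the Chernoff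
    bound.\<close>
  define g where "g = sqrt c"
  define \<tau> where "\<tau> = \<epsilon> / 8"
  have g: "0 < g" "g < 1" "g\<^sup>2 = c" using c by (auto simp: g_def)
  have \<tau>: "0 < \<tau>" "\<tau> \<le> 1 / 8" using eps by (auto simp: \<tau>_def)
  let ?Q = "\<lambda>n. measure_pmf.prob (random_instance n (p n))
    (wife_ranks_within n ((1 - \<epsilon>) * sqrt (p n * real n ^ 3)) ((1 + \<epsilon>) * sqrt (p n * real n ^ 3)))"
  have "?Q \<longlonglongrightarrow> 1"
  proof (rule real_tendsto_sandwich)
    have "\<forall>\<^sub>F n in sequentially. g\<^sup>2 * (ln (real n))\<^sup>2 / real n \<le> 1" by real_asymp
    moreover have "\<forall>\<^sub>F n in sequentially. 8 \<le> \<tau> * (g * ln (real n))" using g \<tau> by real_asymp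
    moreover have "\<forall>\<^sub>F n in sequentially. g * ln (real n) \<le> \<tau> * real n" using g \<tau> by real_asymp
    ultimately show "\<forall>\<^sub>F n in sequentially.
        1 - (real n + 1) * tail_bound n (g\<^sup>2 * (ln (real n))\<^sup>2 / real n) \<tau> \<le> ?Q n"
      using eventually_gt_at_top[of 1]
    proof eventually_elim
      case (elim n)
      have pn: "p n = g\<^sup>2 * (ln (real n))\<^sup>2 / real n" using p[of n] elim g by simp
      have l0: "ln (real n) > 0" using elim by simp
      have n0: "n > 0" and p1: "p n \<le> 1" using elim(1,4) unfolding pn by auto
      have p0: "0 < p n" unfolding pn using g(1) l0 n0 by simp
      have r: "g * ln (real n) = sqrt (p n * real n)"
        using n0 g(1) l0 by (simp add: pn real_sqrt_mult)
      have "p n * real n ^ 3 = (real n)\<^sup>2 * (p n * real n)" by (simp add: power2_eq_square power3_eq_cube)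
      then have S: "sqrt (p n * real n ^ 3) = real n * (g * ln (real n))"
        unfolding r by (simp only: real_sqrt_mult[of "(real n)\<^sup>2"]) simp
      have "measure_pmf.prob (random_instance n (p n)) {(U, V, A). \<exists>M\<in>stable_matchings n U V A.
          \<not> ((1 - \<epsilon>) * sqrt (p n * real n ^ 3) \<le> real (total_wife_rank n U A M) \<and>
             real (total_wife_rank n U A M) \<le> (1 + \<epsilon>) * sqrt (p n * real n ^ 3))}
        \<le> (real n + 1) * tail_bound n (p n) \<tau>"
        using prob_rank_deviation_le[OF r n0 p0 p1 \<tau> elim(2,3)] unfolding S by (simp add: \<tau>_def)
      then show ?case
        using prob_wife_ranks_within_ge[of n "p n" "(1 - \<epsilon>) * sqrt (p n * real n ^ 3)"
          "(1 + \<epsilon>) * sqrt (p n * real n ^ 3)"] unfolding pn[symmetric] by linarith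
    qed
    have "(\<lambda>n. 1 - (real n + 1) * tail_bound n (g\<^sup>2 * (ln (real n))\<^sup>2 / real n) \<tau>) \<longlonglongrightarrow> 1 - 0"
      by (intro tendsto_diff tendsto_const tail_bound_tendsto_0 g \<tau>)
    then show "(\<lambda>n. 1 - (real n + 1) * tail_bound n (g\<^sup>2 * (ln (real n))\<^sup>2 / real n) \<tau>) \<longlonglongrightarrow> 1" by simp
  qed (auto simp: measure_pmf.prob_le_1)
  then have lim: "?Q \<longlonglongrightarrow> 1" .
  show ?thesis
    unfolding prob_husband_ranks_within wife_ranks_within_def[symmetric] by (rule conjI[OF lim lim])
qed

end
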